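(* Let $(X,c)$ be a closure space, and let $\Sigma X$ be its suspension. Then $H_{k+1}(\Sigma X)\cong H_k(X)$ for all $k\ge 1$.
   Context: A (Čech) closure space is a pair $(X,c)$ of a set $X$ and a function $c:2^X\to 2^X$ with $c(\varnothing)=\varnothing$, $A\subset c(A)$, and $c(A\cup B)=c(A)\cup c(B)$ for all $A,B\subset X$. Topological spaces are the closure spaces with $c(c(A))=c(A)$ for all $A$, where $c$ is the topological closure. A map $f:(X,c)\to(Y,d)$ is continuous if $f(c(A))\subset d(f(A))$ for all $A\subset X$. The interior operator is $i(A)=X\setminus c(X\setminus A)$, and $B$ is a neighborhood of $x$ if $x\in i(B)$. The product $X\times Y$ has the closure $c\times d$ in which $(x,y)$ is in the closure of $S$ iff $U\times V$ meets $S$ for all neighborhoods $U$ of $x$ and $V$ of $y$. Suspension: let $I=[0,1]$ with the standard topology $\tau$. $\Sigma X=(X\times I)/\!\sim$, where $\sim$ is generated by $(x,0)\sim(y,0)$ and $(x,1)\sim(y,1)$ for all $x,y\in X$, with quotient map $q$ and quotient closure $c_q(S)=q\big((c\times\tau)(q^{-1}(S))\big)$. Singular homology: let $|\Delta^n|=\{(t_0,\dots,t_n)\in\mathbb{R}^{n+1} : \sum_i t_i=1,\ t_i\ge 0\}=[e_0,\dots,e_n]$ with the Euclidean topology. $C_n(X)$ is the free abelian group on continuous maps $\sigma:|\Delta^n|\to X$ (and $C_n(X)=0$ for $n<0$), $\partial_n(\sigma)=\sum_{i=0}^n(-1)^i\sigma|_{[e_0,\dots,\hat e_i,\dots,e_n]}$,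 and $H_n(X)=\ker\partial_n/\operatorname{im}\partial_{n+1}$. *)

theory Defs
  imports "HOL-Homology.Homology"
begin

section \<open>Closure spaces\<close>

text \<open>
  A closure space is a carrier set together with a function on sets; the values of that function
  matter only on subsets of the carrier.
\<close>

definition closure_space :: "'a set \<Rightarrow> ('a set \<Rightarrow> 'a set) \<Rightarrow> bool" where
  "closure_space X c \<longleftrightarrow>
     (\<forall>A. A \<subseteq> X \<longrightarrow> c A \<subseteq> X) \<and>
     c {} = {} \<and>
     (\<forall>A. A \<subseteq> X \<longrightarrow> A \<subseteq> c A) \<and>
     (\<forall>A B. A \<subseteq> X \<longrightarrow> B \<subseteq> X \<longrightarrow> c (A \<union> B) = c A \<union> c B)"

definition closure_continuous ::
    "'a set \<Rightarrow> ('a set \<Rightarrow> 'a set) \<Rightarrow> 'b set \<Rightarrow> ('b set \<Rightarrow> 'b set) \<Rightarrow> ('a \<Rightarrow> 'b) \<Rightarrow> bool" where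
  "closure_continuous X c Y d f \<longleftrightarrow> f ` X \<subseteq> Y \<and> (\<forall>A. A \<subseteq> X \<longrightarrow> f ` c A \<subseteq> d (f ` A))"

definition closure_interior :: "'a set \<Rightarrow> ('a set \<Rightarrow> 'a set) \<Rightarrow> 'a set \<Rightarrow> 'a set" where
  "closure_interior X c A = X - c (X - A)"

definition closure_nhd :: "'a set \<Rightarrow> ('a set \<Rightarrow> 'a set) \<Rightarrow> 'a \<Rightarrow> 'a set \<Rightarrow> bool" where
  "closure_nhd X c x B \<longleftrightarrow> B \<subseteq> X \<and> x \<in> closure_interior X c B"

definition prod_closure ::
    "'a set \<Rightarrow> ('a set \<Rightarrow> 'a set) \<Rightarrow> 'b set \<Rightarrow> ('b set \<Rightarrow> 'b set) \<Rightarrow> ('a \<times> 'b) set \<Rightarrow> ('a \<times> 'b) set" where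
  "prod_closure X c Y d S =
     {(x, y) \<in> X \<times> Y. \<forall>U V. closure_nhd X c x U \<longrightarrow> closure_nhd Y d y V \<longrightarrow> (U \<times> V) \<inter> S \<noteq> {}}"


section \<open>Suspension\<close>

definition generated_equiv :: "'a set \<Rightarrow> ('a \<times> 'a) set \<Rightarrow> ('a \<times> 'a) set" where
  "generated_equiv A g = \<Inter>{r. equiv A r \<and> g \<subseteq> r}"

abbreviation unit_interval :: "real set" where
  "unit_interval \<equiv> {0..1}"

abbreviation unit_interval_closure :: "real set \<Rightarrow> real set" where
  "unit_interval_closure \<equiv> (closure_of) (top_of_set unit_interval)"

definition suspension_rel :: "'a set \<Rightarrow> (('a \<times> real) \<times> ('a \<times> real)) set" where
  "suspension_rel X =
     generated_equiv (X \<times> unit_interval)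
       ({((x, 0), (y, 0)) | x y. x \<in> X \<and> y \<in> X} \<union> {((x, 1), (y, 1)) | x y. x \<in> X \<and> y \<in> X})"

definition suspension_proj :: "'a set \<Rightarrow> 'a \<times> real \<Rightarrow> ('a \<times> real) set" where
  "suspension_proj X p = suspension_rel X `` {p}"

definition suspension_space :: "'a set \<Rightarrow> ('a \<times> real) set set" where
  "suspension_space X = (X \<times> unit_interval) // suspension_rel X"

definition suspension_closure ::
    "'a set \<Rightarrow> ('a set \<Rightarrow> 'a set) \<Rightarrow> ('a \<times> real) set set \<Rightarrow> ('a \<times> real) set set" where
  "suspension_closure X c S =
     suspension_proj X `
       prod_closure X c unit_interval unit_interval_closure
         {p \<in> X \<times> unit_interval. suspension_proj X p \<in> S}"


section \<open>Singular homology of closure spaces\<close>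

text \<open>
  As in \<^theory>\<open>HOL-Homology.Simplices\<close>, a simplex is a function on \<open>nat \<Rightarrow> real\<close> that is
  \<^const>\<open>undefined\<close> off the standard simplex.  On the standard simplex, whose points vanish
  beyond index \<open>n\<close>, the product topology is the Euclidean one.  The chain type and
  \<^const>\<open>chain_boundary\<close> of that theory do not refer to a topology on the target space, and
  \<^const>\<open>chain_boundary\<close> is zero in degree 0, in accordance with trivial chain groups in
  negative degrees.
\<close>

definition closure_singular_simplex ::
    "nat \<Rightarrow> 'a set \<Rightarrow> ('a set \<Rightarrow> 'a set) \<Rightarrow> ((nat \<Rightarrow> real) \<Rightarrow> 'a) \<Rightarrow> bool" where
  "closure_singular_simplex n X c f \<longleftrightarrow>
     closure_continuous (standard_simplex n)
       ((closure_of) (subtopology (powertop_real UNIV) (standard_simplex n))) X c f \<and>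
     f \<in> extensional (standard_simplex n)"

definition closure_chain_group ::
    "nat \<Rightarrow> 'a set \<Rightarrow> ('a set \<Rightarrow> 'a set) \<Rightarrow> 'a chain monoid" where
  "closure_chain_group n X c = free_Abelian_group (Collect (closure_singular_simplex n X c))"

definition closure_cycles :: "nat \<Rightarrow> 'a set \<Rightarrow> ('a set \<Rightarrow> 'a set) \<Rightarrow> 'a chain set" where
  "closure_cycles n X c = {z \<in> carrier (closure_chain_group n X c). chain_boundary n z = 0}"

definition closure_boundaries :: "nat \<Rightarrow> 'a set \<Rightarrow> ('a set \<Rightarrow> 'a set) \<Rightarrow> 'a chain set" where
  "closure_boundaries n X c = chain_boundary (Suc n) ` carrier (closure_chain_group (Suc n) X c)"

definition closure_homology_group ::
    "nat \<Rightarrow> 'a set \<Rightarrow> ('a set \<Rightarrow> 'a set) \<Rightarrow> 'a chain set monoid" where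
  "closure_homology_group n X c =
     subgroup_generated (closure_chain_group n X c) (closure_cycles n X c)
       Mod closure_boundaries n X c"

end

theory Submission
  imports Defs
begin

text \<open>
  The two cones of the suspension, obtained by removing one apex each, are contractible, and
  their intersection \<open>X \<times> (0, 1)\<close> is homotopy equivalent to \<open>X\<close>.  The Mayer-Vietoris sequence of the
  two cones therefore identifies the homology of the suspension in degree \<open>k + 1\<close> with that of \<open>X\<close>
  in degree \<open>k\<close>, the cones having no homology in positive degrees.  The proof follows
  this argument on the level of cycles: a cycle \<open>x\<close> of \<open>X\<close>, placed on the equator, is filled in
  by a chain in either cone, and the difference of the two fillings is the cycle of the suspension
  that corresponds to \<open>x\<close>.  The lemmas \<open>suspends_surj\<close> and \<open>suspends_boundary_iff\<close> show that
  this correspondence of cycles is bijective up to boundaries.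

  The singular simplices of a closure space are in general not those of any topology, so results on
  topological spaces do not apply to the target.  They do apply to the source:
  every simplex is the image of the identity simplex of the standard simplex, and natural
  constructions on chains are given by chains of topological model spaces, which can be pushed
  forward along maps into a closure space.  In this way subdivision is inherited, and the method of
  acyclic models on the cylinders \<open>\<Delta>\<^sup>p \<times> [0, 1]\<close> gives \<open>homologous_by_homotopy\<close>, which covers both
  homotopies and subdivision.

  The closure of the suspension enters through \<open>suspension_nhd_iff\<close>.  Products with the interval
  need not preserve quotients of closure spaces, so the contraction of a cone is shown to be
  continuous by hand, in \<open>cont_into_contract\<close>.  Small chains come from the height function: it is
  continuous, the cones are the preimages of open sets of heights, and subdivision makes every
  simplex small with respect to these (\<open>suspension_chain_subdivision_splits\<close>).
\<close>

section \<open>Maps from topological spaces into closure spaces\<close>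

abbreviation cont_into ::
    "'t topology \<Rightarrow> 'a set \<Rightarrow> ('a set \<Rightarrow> 'a set) \<Rightarrow> ('t \<Rightarrow> 'a) \<Rightarrow> bool" where
  "cont_into T X c \<equiv> closure_continuous (topspace T) ((closure_of) T) X c"

lemma closure_space_mono:
  assumes "closure_space X c" "A \<subseteq> B" "B \<subseteq> X"
  shows "c A \<subseteq> c B"
proof -
  have "c (A \<union> B) = c A \<union> c B"
    using assms unfolding closure_space_def by (meson subset_trans)
  then show ?thesis
    using assms(2) by (simp add: Un_absorb1 subset_Un_eq)
qed

text \<open>
  For maps out of a topological space, continuity into a closure space is continuity at each point
  in terms of neighbourhoods.  This direction is stated for monotone closures so that it applies to
  the suspension, whose closure is evidently monotone.
\<close>

lemma cont_into_nhdD: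
  assumes mono: "\<And>A B. A \<subseteq> B \<Longrightarrow> B \<subseteq> X \<Longrightarrow> c A \<subseteq> c B"
    and f: "cont_into T X c f" and x: "x \<in> topspace T" and W: "closure_nhd X c (f x) W"
  obtains V where "openin T V" "x \<in> V" "f ` V \<subseteq> W"
proof
  define A where "A = {y \<in> topspace T. f y \<notin> W}"
  have fX: "f ` topspace T \<subseteq> X" and fA: "f ` (T closure_of A) \<subseteq> c (f ` A)"
    using f by (auto simp: closure_continuous_def A_def)
  have "c (f ` A) \<subseteq> c (X - W)"
    by (rule mono) (use fX in \<open>auto simp: A_def\<close>)
  moreover have "f x \<notin> c (X - W)"
    using W by (auto simp: closure_nhd_def closure_interior_def)
  ultimately have "x \<notin> T closure_of A"
    using fA by blast
  then show "x \<in> topspace T - T closure_of A"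
    using x by blast
  show "openin T (topspace T - T closure_of A)"
    by (intro openin_diff openin_topspace closedin_closure_of)
  show "f ` (topspace T - T closure_of A) \<subseteq> W"
    using closure_of_subset_Int[of T A] by (auto simp: A_def)
qed

lemma cont_into_nhdI:
  assumes fX: "f ` topspace T \<subseteq> X"
    and nhd: "\<And>x W. x \<in> topspace T \<Longrightarrow> closure_nhd X c (f x) W \<Longrightarrow>
                \<exists>V. openin T V \<and> x \<in> V \<and> f ` V \<subseteq> W"
  shows "cont_into T X c f"
  unfolding closure_continuous_def
proof (intro conjI allI impI subsetI)
  fix A z
  assume A: "A \<subseteq> topspace T" and "z \<in> f ` (T closure_of A)"
  then obtain x where x: "x \<in> T closure_of A" "z = f x"
    by blast
  have xT: "x \<in> topspace T"
    using x(1) by (simp add: in_closure_of)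
  show "z \<in> c (f ` A)"
  proof (rule ccontr)
    assume z: "z \<notin> c (f ` A)"
    have "X - (X - f ` A) = f ` A"
      using A fX by blast
    then have "closure_nhd X c (f x) (X - f ` A)"
      using z x fX xT by (auto simp: closure_nhd_def closure_interior_def)
    then obtain V where V: "openin T V" "x \<in> V" "f ` V \<subseteq> X - f ` A"
      using nhd[OF xT] by blast
    then obtain y where "y \<in> V" "y \<in> A"
      using x(1) by (auto simp: in_closure_of)
    with V show False
      by blast
  qed
qed (use fX in auto)

lemma cont_into_compose:
  assumes "continuous_map T' T g" "cont_into T X c f"
  shows "cont_into T' X c (f \<circ> g)"
  unfolding closure_continuous_def
proof (intro conjI allI impI)
  show "(f \<circ> g) ` topspace T' \<subseteq> X"
    using assms by (auto simp: closure_continuous_def continuous_map_def)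
  fix A
  assume A: "A \<subseteq> topspace T'"
  have "g ` A \<subseteq> topspace T"
    using A assms(1) by (auto simp: continuous_map_def)
  then have "f ` (T closure_of (g ` A)) \<subseteq> c (f ` g ` A)"
    using assms(2) by (auto simp: closure_continuous_def)
  moreover have "g ` (T' closure_of A) \<subseteq> T closure_of (g ` A)"
    by (rule continuous_map_image_closure_subset[OF assms(1)])
  ultimately show "(f \<circ> g) ` (T' closure_of A) \<subseteq> c ((f \<circ> g) ` A)"
    by (metis image_comp image_mono subset_trans)
qed

lemma cont_into_cong:
  assumes "\<And>x. x \<in> topspace T \<Longrightarrow> f x = g x"
  shows "cont_into T X c f \<longleftrightarrow> cont_into T X c g"
proof -
  have 1: "f ` topspace T = g ` topspace T"
    using assms by (auto simp: image_iff)
  have 2: "f ` A = g ` A \<and> f ` (T closure_of A) = g ` (T closure_of A)" if "A \<subseteq> topspace T" for A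
    using that assms closure_of_subset_topspace[of T A] by (force intro: image_cong)
  show ?thesis
    unfolding closure_continuous_def 1 using 2 by metis
qed

section \<open>Singular chains of a closure space\<close>

abbreviation simplex_topology :: "nat \<Rightarrow> (nat \<Rightarrow> real) topology" where
  "simplex_topology p \<equiv> subtopology (powertop_real UNIV) (standard_simplex p)"

abbreviation identity_simplex :: "nat \<Rightarrow> (nat \<Rightarrow> real) chain" where
  "identity_simplex p \<equiv> frag_of (restrict id (standard_simplex p))"

lemma singular_chain_identity_simplex:
  "singular_chain p (simplex_topology p) (identity_simplex p)"
  by (metis simplicial_chain_of simplicial_imp_singular_chain simplicial_simplex_id subset_refl)

lemma closure_singular_simplex_iff:
  "closure_singular_simplex p X c f \<longleftrightarrow>
     cont_into (simplex_topology p) X c f \<and> f \<in> extensional (standard_simplex p)"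
  by (simp add: closure_singular_simplex_def)

text \<open>
  The set \<open>S\<close> bounds the images of the simplices.  Chains in a subspace \<open>S\<close> are thus chains of the
  whole space with small support, and no subspace closure has to be introduced.
\<close>

definition closure_chain ::
    "nat \<Rightarrow> 'a set \<Rightarrow> ('a set \<Rightarrow> 'a set) \<Rightarrow> 'a set \<Rightarrow> 'a chain \<Rightarrow> bool" where
  "closure_chain p X c S z \<longleftrightarrow>
     Poly_Mapping.keys z \<subseteq> {f. closure_singular_simplex p X c f \<and> f ` standard_simplex p \<subseteq> S}"

lemma carrier_closure_chain_group:
  "z \<in> carrier (closure_chain_group p X c) \<longleftrightarrow> closure_chain p X c X z"
proof -
  have "f ` standard_simplex p \<subseteq> X" if "closure_singular_simplex p X c f" for f
    using that by (simp add: closure_singular_simplex_def closure_continuous_def)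
  then show ?thesis
    by (auto simp: closure_chain_group_def closure_chain_def)
qed

lemma closure_chain_0 [simp]: "closure_chain p X c S 0"
  by (simp add: closure_chain_def)

lemma closure_chain_of:
  "closure_chain p X c S (frag_of f) \<longleftrightarrow>
     closure_singular_simplex p X c f \<and> f ` standard_simplex p \<subseteq> S"
  by (simp add: closure_chain_def)

lemma closure_chain_diff:
  "closure_chain p X c S y \<Longrightarrow> closure_chain p X c S z \<Longrightarrow> closure_chain p X c S (y - z)"
  unfolding closure_chain_def using keys_diff[of y z] by blast

lemma closure_chain_minus: "closure_chain p X c S z \<Longrightarrow> closure_chain p X c S (- z)"
  by (simp add: closure_chain_def)

lemma closure_chain_add:
  "closure_chain p X c S y \<Longrightarrow> closure_chain p X c S z \<Longrightarrow> closure_chain p X c S (y + z)"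
  unfolding closure_chain_def using keys_add[of y z] by blast

lemma closure_chain_cmul: "closure_chain p X c S z \<Longrightarrow> closure_chain p X c S (frag_cmul a z)"
  by (auto simp: closure_chain_def)

lemma closure_chain_mono:
  "closure_chain p X c S z \<Longrightarrow> S \<subseteq> S' \<Longrightarrow> closure_chain p X c S' z"
  unfolding closure_chain_def by blast

lemma closure_chain_Int:
  "closure_chain p X c (S \<inter> S') z \<longleftrightarrow> closure_chain p X c S z \<and> closure_chain p X c S' z"
  unfolding closure_chain_def by blast

lemma closure_chain_sum:
  "(\<And>i. i \<in> I \<Longrightarrow> closure_chain p X c S (f i)) \<Longrightarrow> closure_chain p X c S (\<Sum>i\<in>I. f i)"
  unfolding closure_chain_def using keys_sum[of f I] by blast

lemma closure_chain_extend:
  assumes "closure_chain p X c S z"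
    and "\<And>f. closure_singular_simplex p X c f \<Longrightarrow> f ` standard_simplex p \<subseteq> S \<Longrightarrow>
           closure_chain q Y d R (F f)"
  shows "closure_chain q Y d R (frag_extend F z)"
  unfolding frag_extend_def
  by (intro closure_chain_sum closure_chain_cmul assms(2))
     (use assms(1) in \<open>auto simp: closure_chain_def\<close>)

text \<open>
  The bridge from topological to closure-theoretic chains: chains of a topological model space,
  on which the known theory is available, are pushed into a closure space along a continuous map.
\<close>

lemma closure_chain_push:
  assumes "singular_chain q T d" "cont_into T X c f" "f ` topspace T \<subseteq> S"
  shows "closure_chain q X c S (chain_map q f d)"
proof -
  have "closure_chain q X c S (frag_of (simplex_map q f g))" if g: "g \<in> Poly_Mapping.keys d" for g
  proof -
    have g: "continuous_map (simplex_topology q) T g"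
      using g assms(1) by (auto simp: singular_chain_def singular_simplex_def)
    have "cont_into (simplex_topology q) X c (f \<circ> g)"
      by (rule cont_into_compose[OF g assms(2)])
    then have "cont_into (simplex_topology q) X c (simplex_map q f g)"
      by (subst cont_into_cong[where g = "f \<circ> g"]) (auto simp: simplex_map_def)
    moreover have "simplex_map q f g ` standard_simplex q \<subseteq> S"
      using g assms(3) by (auto simp: simplex_map_def continuous_map_def)
    ultimately show ?thesis
      by (simp add: closure_chain_of closure_singular_simplex_iff simplex_map_def)
  qed
  then show ?thesis
    unfolding chain_map_def frag_extend_def
    by (auto intro!: closure_chain_sum closure_chain_cmul)
qed

lemma closure_chain_push_simplex:
  assumes "closure_singular_simplex p X c f" "f ` standard_simplex p \<subseteq> S"
    and "singular_chain q (simplex_topology p) d"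
  shows "closure_chain q X c S (chain_map q f d)"
  by (rule closure_chain_push[OF assms(3)])
     (use assms in \<open>auto simp: closure_singular_simplex_iff\<close>)

text \<open>
  Giving the target the indiscrete topology makes every extensional function on a standard
  simplex a singular simplex in the sense of the topological theory.  Hence all purely algebraic
  identities between chains proved there, such as \<open>\<partial> \<circ> \<partial> = 0\<close> or the compatibility of
  subdivision with boundaries, hold for chains of a closure space as well.
\<close>

definition indiscrete_topology :: "'a topology" where
  "indiscrete_topology = pullback_topology UNIV (\<lambda>_. ()) (discrete_topology UNIV)"

lemma topspace_indiscrete [simp]: "topspace indiscrete_topology = UNIV"
  by (simp add: indiscrete_topology_def topspace_pullback_topology)

lemma continuous_map_indiscrete [simp]: "continuous_map T indiscrete_topology f"
  unfolding indiscrete_topology_def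
  by (rule continuous_map_pullback') (auto simp: o_def)

lemma closure_chain_imp_singular_chain_subtopology:
  "closure_chain p X c S z \<Longrightarrow> singular_chain p (subtopology indiscrete_topology S) z"
  unfolding closure_chain_def singular_chain_def
  by (erule order_trans)
     (auto simp: singular_simplex_def closure_singular_simplex_def continuous_map_in_subtopology
        simp flip: image_subset_iff_funcset)

lemma closure_chain_imp_singular_chain:
  "closure_chain p X c S z \<Longrightarrow> singular_chain p indiscrete_topology z"
  using closure_chain_imp_singular_chain_subtopology[of p X c S z]
  by (simp add: singular_chain_subtopology)

lemma chain_map_closure_chain_cong:
  assumes "closure_chain p X c S z" "\<And>x. x \<in> S \<Longrightarrow> g x = h x"
  shows "chain_map p g z = chain_map p h z"
  by (rule chain_map_eq[OF closure_chain_imp_singular_chain_subtopology[OF assms(1)]])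
     (use assms(2) in auto)

lemma chain_map_closure_chain_id:
  assumes "closure_chain p X c S z" "\<And>x. x \<in> S \<Longrightarrow> g x = x"
  shows "chain_map p g z = z"
  by (rule chain_map_id_gen[OF closure_chain_imp_singular_chain_subtopology[OF assms(1)]])
     (use assms(2) in auto)

lemma closure_chain_chain_map:
  assumes z: "closure_chain p X c S z"
    and g: "\<And>f. closure_singular_simplex p X c f \<Longrightarrow> f ` standard_simplex p \<subseteq> S \<Longrightarrow>
          cont_into (simplex_topology p) Y d (\<lambda>x. g (f x)) \<and> (\<lambda>x. g (f x)) ` standard_simplex p \<subseteq> R"
  shows "closure_chain p Y d R (chain_map p g z)"
  unfolding chain_map_def
proof (rule closure_chain_extend[OF z])
  fix f
  assume f: "closure_singular_simplex p X c f" "f ` standard_simplex p \<subseteq> S"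
  have "cont_into (simplex_topology p) Y d (simplex_map p g f)"
    using g[OF f] by (subst cont_into_cong[where g = "\<lambda>x. g (f x)"]) (auto simp: simplex_map_def)
  then show "closure_chain p Y d R ((frag_of \<circ> simplex_map p g) f)"
    using g[OF f] by (auto simp: closure_chain_of closure_singular_simplex_iff simplex_map_def)
qed

lemma chain_map_identity_simplex:
  assumes "f \<in> extensional (standard_simplex p)"
  shows "chain_map p f (identity_simplex p) = frag_of f"
  by (rule singular_simplex_chain_map_id[where X = indiscrete_topology])
     (simp add: singular_simplex_def assms)

text \<open>
  A simplex is the image of the identity simplex under itself.  Operators that are natural, such as
  the boundary here and subdivision below, are therefore determined by their value on the identity
  simplex, and their values on a simplex of a closure space are pushed forward from topological
  chains of the standard simplex.
\<close>

lemma chain_boundary_of_simplex: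
  assumes "f \<in> extensional (standard_simplex p)"
  shows "chain_boundary p (frag_of f)
           = chain_map (p - Suc 0) f (chain_boundary p (identity_simplex p))"
  using chain_boundary_chain_map[OF singular_chain_identity_simplex, of p f]
  by (simp only: chain_map_identity_simplex[OF assms])

lemma frag_extend_of_zero: "frag_extend (\<lambda>_. 0) z = 0"
  by (simp add: frag_extend_def)

lemma chain_boundary_extend:
  "chain_boundary p z = frag_extend (\<lambda>f. chain_boundary p (frag_of f)) z"
  by (simp add: chain_boundary_def frag_extend_of_zero)

lemma closure_chain_boundary:
  assumes "closure_chain p X c S z"
  shows "closure_chain (p - Suc 0) X c S (chain_boundary p z)"
  unfolding chain_boundary_extend[of p z]
proof (rule closure_chain_extend[OF assms])
  fix f
  assume f: "closure_singular_simplex p X c f" "f ` standard_simplex p \<subseteq> S"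
  then have "f \<in> extensional (standard_simplex p)"
    by (simp add: closure_singular_simplex_iff)
  then show "closure_chain (p - Suc 0) X c S (chain_boundary p (frag_of f))"
    using closure_chain_push_simplex[OF f
        singular_chain_boundary[OF singular_chain_identity_simplex]]
    by (simp only: chain_boundary_of_simplex)
qed

lemma closure_chain_boundary_Suc:
  "closure_chain (Suc p) X c S z \<Longrightarrow> closure_chain p X c S (chain_boundary (Suc p) z)"
  using closure_chain_boundary[of "Suc p"] by simp

lemma closure_chain_boundary_boundary:
  "closure_chain (Suc p) X c S z \<Longrightarrow> chain_boundary p (chain_boundary (Suc p) z) = 0"
  by (rule chain_boundary_boundary_alt[OF closure_chain_imp_singular_chain])

lemma singular_chain_iterated_subdivision:
  "singular_chain p T z \<Longrightarrow> singular_chain p T ((singular_subdivision p ^^ n) z)"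
  by (induction n) (auto intro: singular_chain_singular_subdivision)

lemma chain_boundary_iterated_subdivision:
  assumes "singular_chain p T z"
  shows "chain_boundary p ((singular_subdivision p ^^ n) z)
           = (singular_subdivision (p - Suc 0) ^^ n) (chain_boundary p z)"
proof (induction n)
  case (Suc n)
  then show ?case
    using chain_boundary_singular_subdivision[OF singular_chain_iterated_subdivision[OF assms, of n]]
    by simp
qed simp

lemma naturality_iterated_subdivision:
  assumes "singular_chain p T z"
  shows "(singular_subdivision p ^^ n) (chain_map p g z)
           = chain_map p g ((singular_subdivision p ^^ n) z)"
proof (induction n)
  case (Suc n)
  then show ?case
    using naturality_singular_subdivision[OF singular_chain_iterated_subdivision[OF assms, of n]]
    by simp
qed simp

lemma iterated_subdivision_of_simplex:
  assumes "f \<in> extensional (standard_simplex p)"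
  shows "(singular_subdivision p ^^ n) (frag_of f)
           = chain_map p f ((singular_subdivision p ^^ n) (identity_simplex p))"
  using naturality_iterated_subdivision[OF singular_chain_identity_simplex, of n p f]
  by (simp only: chain_map_identity_simplex[OF assms])

lemma closure_chain_iterated_subdivision:
  assumes "closure_chain p X c S z"
  shows "closure_chain p X c S ((singular_subdivision p ^^ n) z)"
  using assms unfolding closure_chain_def[of p X c S z]
proof (induction z rule: frag_induction)
  case (one f)
  then have f: "closure_singular_simplex p X c f" "f ` standard_simplex p \<subseteq> S"
    by auto
  then have "f \<in> extensional (standard_simplex p)"
    by (simp add: closure_singular_simplex_iff)
  then show ?case
    using closure_chain_push_simplex[OF f
        singular_chain_iterated_subdivision[OF singular_chain_identity_simplex]]
    by (simp only: iterated_subdivision_of_simplex)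
qed (auto simp: singular_subdivision_power_diff closure_chain_diff)

section \<open>Homotopies\<close>

text \<open>
  Homotopy invariance replaces the cycle by its image under a constant map, and in positive
  degrees every cycle of a one-point space bounds.
\<close>

lemma contractible_cycle_imp_boundary:
  assumes X: "contractible_space X" and c: "singular_chain p X c" "chain_boundary p c = 0"
    and p: "1 \<le> p"
  obtains d where "singular_chain (Suc p) X d" "chain_boundary (Suc p) d = c"
proof -
  obtain a where h: "homotopic_with (\<lambda>h. h \<in> {} \<rightarrow> {}) X X id (\<lambda>x. a)"
    using X by (auto simp: contractible_space_def)
  have rc: "singular_relcycle p X {} c"
    using c by (simp add: singular_cycle)
  have "homologous_rel p X {} (chain_map p id c) (chain_map p (\<lambda>x. a) c)"
    by (rule homotopic_imp_homologous_rel_chain_maps[OF h rc])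
  then have hom: "singular_relboundary p X {} (c - chain_map p (\<lambda>x. a) c)"
    using chain_map_ident[OF c(1)] by (simp add: homologous_rel_def)
  show thesis
  proof (cases "topspace X = {}")
    case True
    then have "c = 0"
      using c(1) by (simp add: singular_chain_empty)
    then show thesis
      using that[of 0] by simp
  next
    case False
    have "continuous_map X X (\<lambda>x. a)"
      using homotopic_with_imp_continuous_maps[OF h] by simp
    then have a: "a \<in> topspace X"
      using False by (auto simp: continuous_map_def)
    let ?A = "subtopology X {a}"
    have tA: "topspace ?A = {a}"
      using a by auto
    have "singular_relcycle p ?A {} (chain_map p (\<lambda>x. a) c)"
      by (rule singular_relcycle_chain_map[OF rc]) (use a in auto)
    then have "singular_relboundary p ?A {} (chain_map p (\<lambda>x. a) c)"
      by (simp add: singular_boundary_eq_cycle_singleton[OF tA p])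
    then have "singular_relboundary p X {} (chain_map p (\<lambda>x. a) c)"
      using singular_boundary_mono[of "{a}" "topspace X" p X] a by simp
    then have "singular_relboundary p X {} c"
      using singular_relboundary_add[OF hom, of "chain_map p (\<lambda>x. a) c"] by simp
    then show thesis
      using that by (auto simp: singular_boundary)
  qed
qed

abbreviation cylinder :: "nat \<Rightarrow> ((nat \<Rightarrow> real) \<times> real) topology" where
  "cylinder p \<equiv> prod_topology (simplex_topology p) (top_of_set {0..1})"

text \<open>
  The straight line to the vertex \<open>(e\<^sub>0, 0)\<close> stays in the cylinder, which is convex.
\<close>

lemma contractible_cylinder: "contractible_space (cylinder p)"
proof -
  let ?v = "\<lambda>i::nat. if i = 0 then 1 else (0::real)"
  let ?h = "\<lambda>z::real \<times> (nat \<Rightarrow> real) \<times> real.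
              (\<lambda>i. (1 - fst z) * fst (snd z) i + fst z * ?v i, (1 - fst z) * snd (snd z))"
  let ?P = "prod_topology (top_of_set {0..1::real}) (cylinder p)"
  have t: "continuous_map ?P euclideanreal fst"
    using continuous_map_fst[of "top_of_set {0..1::real}"] by (rule continuous_map_into_fulltopology)
  have y: "continuous_map ?P (simplex_topology p) (\<lambda>z. fst (snd z))"
    using continuous_map_compose[OF continuous_map_snd continuous_map_fst] by (simp add: o_def)
  have yi: "continuous_map ?P euclideanreal (\<lambda>z. fst (snd z) i)" for i
    using continuous_map_into_fulltopology[OF y] by (simp add: continuous_map_componentwise_UNIV)
  have s: "continuous_map ?P (top_of_set {0..1}) (\<lambda>z. snd (snd z))"
    using continuous_map_compose[OF continuous_map_snd continuous_map_snd] by (simp add: o_def)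
  have s': "continuous_map ?P euclideanreal (\<lambda>z. snd (snd z))"
    using s by (rule continuous_map_into_fulltopology)
  have v: "?v \<in> standard_simplex p"
    by simp
  have c1: "continuous_map ?P (simplex_topology p)
              (\<lambda>z i. (1 - fst z) * fst (snd z) i + fst z * ?v i)"
    unfolding continuous_map_in_subtopology continuous_map_componentwise_UNIV
    using convex_standard_simplex[OF _ v]
    by (auto intro!: continuous_map_add continuous_map_real_mult continuous_map_diff t yi)
  have c2: "continuous_map ?P (top_of_set {0..1}) (\<lambda>z. (1 - fst z) * snd (snd z))"
    unfolding continuous_map_in_subtopology
    by (auto intro!: continuous_map_real_mult continuous_map_diff t s' mult_le_one)
  have "continuous_map ?P (cylinder p) ?h"
    using c1 c2 by (simp add: continuous_map_pairwise o_def)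
  then have "homotopic_with (\<lambda>x. True) (cylinder p) (cylinder p) id (\<lambda>x. (?v, 0))"
    unfolding homotopic_with_def by (intro exI[of _ ?h]) auto
  then show ?thesis
    unfolding contractible_space_def by blast
qed

text \<open>
  A chain \<open>h\<close> of the model cylinder acts on all simplices \<open>f\<close> by means of \<open>f \<times> id\<close>.  This is
  the general form of a natural operation raising the degree by one; the prism operator is an
  instance.
\<close>

definition cylinder_sweep ::
    "nat \<Rightarrow> ((nat \<Rightarrow> real) \<times> real) chain \<Rightarrow> 'a chain \<Rightarrow> ('a \<times> real) chain" where
  "cylinder_sweep p h = frag_extend (\<lambda>f. chain_map (Suc p) (map_prod f id) h)"

lemma cylinder_sweep_0 [simp]: "cylinder_sweep p h 0 = 0"
  by (simp add: cylinder_sweep_def)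

lemma cylinder_sweep_diff:
  "cylinder_sweep p h (y - z) = cylinder_sweep p h y - cylinder_sweep p h z"
  by (simp add: cylinder_sweep_def frag_extend_diff)

lemma chain_map_chain_map: "chain_map p g (chain_map p f z) = chain_map p (\<lambda>x. g (f x)) z"
  using fun_cong[OF chain_map_compose[of p g f], of z] by (simp add: o_def)

lemma chain_map_eq_chain_map_compose:
  assumes "singular_chain p X z" "\<And>x. x \<in> topspace X \<Longrightarrow> f x = g (h x)"
  shows "chain_map p f z = chain_map p g (chain_map p h z)"
  unfolding chain_map_chain_map by (rule chain_map_eq[OF assms])

text \<open>
  Naturality holds by construction, because \<open>(g \<circ> f) \<times> id\<close> factors through \<open>f \<times> id\<close>.
\<close>

lemma cylinder_sweep_natural:
  assumes h: "singular_chain (Suc p) (cylinder p) h" and z: "singular_chain p X z"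
  shows "cylinder_sweep p h (chain_map p g z) = chain_map (Suc p) (map_prod g id) (cylinder_sweep p h z)"
  using z unfolding singular_chain_def
proof (induction z rule: frag_induction)
  case (one f)
  have "chain_map (Suc p) (map_prod (simplex_map p g f) id) h
          = chain_map (Suc p) (map_prod g id) (chain_map (Suc p) (map_prod f id) h)"
    by (rule chain_map_eq_chain_map_compose[OF h]) (auto simp: simplex_map_def)
  then show ?case
    by (simp only: cylinder_sweep_def chain_map_of frag_extend_of)
qed (auto simp: chain_map_diff cylinder_sweep_diff)

lemma singular_chain_cylinder_sweep:
  assumes h: "singular_chain (Suc p) (cylinder p) h" and z: "singular_chain p X z"
  shows "singular_chain (Suc p) (prod_topology X (top_of_set {0..1})) (cylinder_sweep p h z)"
  unfolding cylinder_sweep_def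
proof (rule singular_chain_extend)
  fix f assume "f \<in> Poly_Mapping.keys z"
  then have "continuous_map (simplex_topology p) X f"
    using z by (auto simp: singular_chain_def singular_simplex_def)
  then have "continuous_map (cylinder p) (prod_topology X (top_of_set {0..1})) (map_prod f id)"
    by (simp add: map_prod_def continuous_map_prod_top id_def)
  then show "singular_chain (Suc p) (prod_topology X (top_of_set {0..1})) (chain_map (Suc p) (map_prod f id) h)"
    by (rule singular_chain_chain_map[OF h])
qed

definition cylinder_bottom :: "nat \<Rightarrow> 'a chain \<Rightarrow> ('a \<times> real) chain" where
  "cylinder_bottom p = chain_map p (\<lambda>x. (x, 0))"

definition cylinder_top :: "nat \<Rightarrow> nat \<Rightarrow> 'a chain \<Rightarrow> ('a \<times> real) chain" where
  "cylinder_top n p z = chain_map p (\<lambda>x. (x, 1)) ((singular_subdivision p ^^ n) z)"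

text \<open>
  The equation that makes \<open>h\<close> the degree \<open>p\<close> part of a natural chain homotopy from the bottom of
  the cylinder to the \<open>n\<close>-fold subdivision of its top, when \<open>h'\<close> is the part in degree \<open>p - 1\<close>.
  In degree 0 the boundary of the identity simplex vanishes, so the recursion starts from any \<open>h'\<close>.
\<close>

definition cylinder_homotopy_step ::
    "nat \<Rightarrow> nat \<Rightarrow> ((nat \<Rightarrow> real) \<times> real) chain \<Rightarrow> ((nat \<Rightarrow> real) \<times> real) chain \<Rightarrow> bool" where
  "cylinder_homotopy_step n p h' h \<longleftrightarrow>
     chain_boundary (Suc p) h
       = cylinder_top n p (identity_simplex p) - cylinder_bottom p (identity_simplex p)
         - cylinder_sweep (p - Suc 0) h' (chain_boundary p (identity_simplex p))"

lemma singular_chain_cylinder_ends: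
  assumes "singular_chain p X z"
  shows "singular_chain p (prod_topology X (top_of_set {0..1})) (cylinder_bottom p z)"
    and "singular_chain p (prod_topology X (top_of_set {0..1})) (cylinder_top n p z)"
  unfolding cylinder_bottom_def cylinder_top_def
  by (rule singular_chain_chain_map singular_chain_iterated_subdivision assms
      | simp add: continuous_map_pairwise o_def)+

lemma chain_boundary_cylinder_ends:
  assumes "singular_chain p X z"
  shows "chain_boundary p (cylinder_bottom p z) = cylinder_bottom (p - Suc 0) (chain_boundary p z)"
    and "chain_boundary p (cylinder_top n p z) = cylinder_top n (p - Suc 0) (chain_boundary p z)"
  unfolding cylinder_bottom_def cylinder_top_def
  by (simp_all add: chain_boundary_chain_map[OF assms]
      chain_boundary_chain_map[OF singular_chain_iterated_subdivision[OF assms]]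
      chain_boundary_iterated_subdivision[OF assms])

lemma cylinder_ends_natural:
  assumes z: "singular_chain p X z"
  shows "chain_map p (map_prod g id) (cylinder_bottom p z) = cylinder_bottom p (chain_map p g z)"
    and "chain_map p (map_prod g id) (cylinder_top n p z) = cylinder_top n p (chain_map p g z)"
proof -
  have "chain_map p (map_prod g id) (chain_map p (\<lambda>x. (x, t)) y)
          = chain_map p (\<lambda>x. (x, t)) (chain_map p g y)" for t :: real and y
    by (simp add: chain_map_chain_map)
  then show "chain_map p (map_prod g id) (cylinder_bottom p z) = cylinder_bottom p (chain_map p g z)"
    and "chain_map p (map_prod g id) (cylinder_top n p z) = cylinder_top n p (chain_map p g z)"
    by (simp_all add: cylinder_bottom_def cylinder_top_def naturality_iterated_subdivision[OF z])
qed

text \<open>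
  By naturality, the homotopy equation for the identity simplex implies the one for all chains.
\<close>

lemma chain_boundary_cylinder_sweep:
  assumes h: "singular_chain (Suc p) (cylinder p) h"
    and h': "p > 0 \<Longrightarrow> singular_chain p (cylinder (p - Suc 0)) h'"
    and step: "cylinder_homotopy_step n p h' h"
    and z: "singular_chain p X z"
  shows "chain_boundary (Suc p) (cylinder_sweep p h z)
           = cylinder_top n p z - cylinder_bottom p z
             - cylinder_sweep (p - Suc 0) h' (chain_boundary p z)"
  using z unfolding singular_chain_def
proof (induction z rule: frag_induction)
  case (one f)
  then have f: "f \<in> extensional (standard_simplex p)"
    by (simp add: singular_simplex_def)
  let ?i = "identity_simplex p"
  note i = singular_chain_identity_simplex[of p]
  have sw: "chain_map p (map_prod f id) (cylinder_sweep (p - Suc 0) h' (chain_boundary p ?i))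
          = cylinder_sweep (p - Suc 0) h' (chain_boundary p (frag_of f))"
  proof (cases "p = 0")
    case False
    then show ?thesis
      using cylinder_sweep_natural[OF _ singular_chain_boundary[OF i], of h' f] h'
      by (simp add: chain_boundary_of_simplex[OF f])
  qed (simp add: chain_boundary_def)
  have "chain_boundary (Suc p) (cylinder_sweep p h (frag_of f))
          = chain_map p (map_prod f id) (chain_boundary (Suc p) h)"
    by (simp add: cylinder_sweep_def chain_boundary_chain_map[OF h])
  also have "\<dots> = cylinder_top n p (frag_of f) - cylinder_bottom p (frag_of f)
             - cylinder_sweep (p - Suc 0) h' (chain_boundary p (frag_of f))"
    using step
    by (simp only: cylinder_homotopy_step_def chain_map_diff sw cylinder_ends_natural[OF i]
        chain_map_identity_simplex[OF f])
  finally show ?case .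
next
  case (diff a b)
  then show ?case
    by (simp add: chain_boundary_diff cylinder_sweep_diff cylinder_top_def cylinder_bottom_def
        chain_map_diff singular_subdivision_power_diff)
qed (simp_all add: cylinder_top_def cylinder_bottom_def)

lemma cylinder_homotopy_start:
  obtains h where "singular_chain 1 (cylinder 0) h" "cylinder_homotopy_step n 0 h' h"
proof -
  let ?i = "identity_simplex 0"
  have i: "singular_relcycle 0 (simplex_topology 0) {} ?i"
    by (simp add: singular_cycle singular_chain_identity_simplex chain_boundary_def
        del: singular_chain_of)
  have "homotopic_with (\<lambda>h. h \<in> {} \<rightarrow> {}) (simplex_topology 0) (cylinder 0)
          (\<lambda>x. (x, 0)) (\<lambda>x. (x, 1))"
    unfolding homotopic_with_def
    by (intro exI[of _ "\<lambda>(t, x). (x, t)"])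
       (auto simp: case_prod_unfold continuous_map_pairwise o_def continuous_map_fst continuous_map_snd)
  from homotopic_imp_homologous_rel_chain_maps[OF this i]
  have "singular_relboundary 0 (cylinder 0) {}
          (chain_map 0 (\<lambda>x. (x, 0)) ?i - chain_map 0 (\<lambda>x. (x, 1)) ?i)"
    by (simp add: homologous_rel_def del: chain_map_of)
  then obtain d where d: "singular_chain (Suc 0) (cylinder 0) d"
      "chain_boundary (Suc 0) d = chain_map 0 (\<lambda>x. (x, 0)) ?i - chain_map 0 (\<lambda>x. (x, 1)) ?i"
    by (auto simp only: singular_boundary)
  \<comment> \<open>A 0-simplex is its own subdivision, so it suffices to join the two ends of the cylinder.\<close>
  have "(singular_subdivision 0 ^^ n) ?i = ?i"
  proof (induction n)
    case (Suc n)
    then show ?case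
      by (simp only: funpow.simps comp_apply singular_subdivision_zero[OF singular_chain_identity_simplex])
  qed simp
  then have "cylinder_homotopy_step n 0 h' (- d)"
    unfolding cylinder_homotopy_step_def cylinder_top_def cylinder_bottom_def
    by (simp only: chain_boundary_minus d) (simp add: chain_boundary_def)
  then show thesis
    using that[of "- d"] d(1) by (simp add: singular_chain_minus)
qed

text \<open>
  The next model chain must have a prescribed boundary \<open>r\<close>.  The homotopy equation in degree \<open>p\<close>
  together with \<open>\<partial> \<circ> \<partial> = 0\<close> shows that \<open>r\<close> is a cycle, and cycles of the contractible cylinder
  bound.
\<close>

lemma cylinder_homotopy_next:
  assumes h: "singular_chain (Suc p) (cylinder p) h"
    and h': "p > 0 \<Longrightarrow> singular_chain p (cylinder (p - Suc 0)) h'"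
    and step: "cylinder_homotopy_step n p h' h"
  obtains k where "singular_chain (Suc (Suc p)) (cylinder (Suc p)) k"
    "cylinder_homotopy_step n (Suc p) h k"
proof -
  let ?i = "identity_simplex (Suc p)"
  note i = singular_chain_identity_simplex[of "Suc p"]
  note di = singular_chain_boundary_alt[OF i]
  define r where "r = cylinder_top n (Suc p) ?i - cylinder_bottom (Suc p) ?i
         - cylinder_sweep p h (chain_boundary (Suc p) ?i)"
  have r: "singular_chain (Suc p) (cylinder (Suc p)) r"
    unfolding r_def
    by (intro singular_chain_diff singular_chain_cylinder_ends singular_chain_cylinder_sweep h i di)
  have "chain_boundary (Suc p) r = 0"
    unfolding r_def
    by (simp only: chain_boundary_diff chain_boundary_cylinder_ends[OF i] diff_Suc_Suc diff_zero
        chain_boundary_cylinder_sweep[OF h h' step di] chain_boundary_boundary_alt[OF i] cylinder_sweep_0)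
       simp
  then obtain k where "singular_chain (Suc (Suc p)) (cylinder (Suc p)) k"
      "chain_boundary (Suc (Suc p)) k = r"
    by (rule contractible_cycle_imp_boundary[OF contractible_cylinder r]) auto
  then show thesis
    using that by (simp add: cylinder_homotopy_step_def r_def)
qed

text \<open>
  The method of acyclic models: the model chains are chosen one degree after the other, the
  equation in degree \<open>p\<close> being what makes the choice in degree \<open>p + 1\<close> possible.
\<close>

lemma cylinder_homotopy_exists:
  obtains h where "\<And>p. singular_chain (Suc p) (cylinder p) (h p)"
    and "\<And>p. cylinder_homotopy_step n p (h (p - Suc 0)) (h p)"
proof -
  \<comment> \<open>Pairs of consecutive model chains, as the equation in degree \<open>p\<close> involves two of them.\<close>
  define P where "P p u \<longleftrightarrow> singular_chain (Suc p) (cylinder p) (snd u) \<and>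
      (p > 0 \<longrightarrow> singular_chain p (cylinder (p - Suc 0)) (fst u)) \<and>
      cylinder_homotopy_step n p (fst u) (snd u)" for p u
  obtain h0 where h0: "singular_chain 1 (cylinder 0) h0" "cylinder_homotopy_step n 0 0 h0"
    by (rule cylinder_homotopy_start)
  have "P 0 (0, h0)"
    using h0 by (simp add: P_def)
  moreover have "\<exists>v. P (Suc p) v \<and> fst v = snd u" if "P p u" for p u
  proof -
    have "\<exists>k. singular_chain (Suc (Suc p)) (cylinder (Suc p)) k \<and>
        cylinder_homotopy_step n (Suc p) (snd u) k"
      by (rule cylinder_homotopy_next[of p "snd u" "fst u" n]) (use that in \<open>auto simp: P_def\<close>)
    then obtain k where "singular_chain (Suc (Suc p)) (cylinder (Suc p)) k"
        "cylinder_homotopy_step n (Suc p) (snd u) k"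
      by blast
    then have "P (Suc p) (snd u, k)"
      using that by (simp add: P_def)
    then show ?thesis
      by auto
  qed
  ultimately obtain u where u: "\<And>p. P p (u p)" "\<And>p. fst (u (Suc p)) = snd (u p)"
    using dependent_nat_choice[of P "\<lambda>_ u v. fst v = snd u"] by metis
  have "cylinder_homotopy_step n p (snd (u (p - Suc 0))) (snd (u p))" for p
  proof (cases p)
    case 0
    then show ?thesis
      using u(1)[of 0] by (simp add: P_def cylinder_homotopy_step_def chain_boundary_def)
  next
    case (Suc q)
    then show ?thesis
      using u(1)[of p] u(2)[of q] by (simp add: P_def)
  qed
  then show thesis
    using that[of "\<lambda>p. snd (u p)"] u(1) by (simp add: P_def)
qed

text \<open>
  The homotopy \<open>\<Gamma>\<close> is tested on its composites with \<open>f \<times> id\<close> for simplices \<open>f\<close>.  These start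
  from a topological space, which avoids products of closure spaces with the interval.  Allowing \<open>n\<close> subdivisions at the end of the homotopy yields invariance under
  homotopy and invariance under subdivision from the same model chains.
\<close>

proposition homologous_by_homotopy:
  assumes \<Gamma>: "\<And>f. closure_singular_simplex p X c f \<Longrightarrow> f ` standard_simplex p \<subseteq> S \<Longrightarrow>
          cont_into (cylinder p) Y d (\<lambda>(x, t). \<Gamma> (f x) t) \<and>
          (\<lambda>(x, t). \<Gamma> (f x) t) ` topspace (cylinder p) \<subseteq> R"
    and z: "closure_chain p X c S z" "chain_boundary p z = 0"
  obtains w where "closure_chain (Suc p) Y d R w"
    and "chain_boundary (Suc p) w
           = chain_map p (\<lambda>x. \<Gamma> x 1) ((singular_subdivision p ^^ n) z) - chain_map p (\<lambda>x. \<Gamma> x 0) z"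
proof -
  obtain h where h: "\<And>p. singular_chain (Suc p) (cylinder p) (h p)"
      "\<And>p. cylinder_homotopy_step n p (h (p - Suc 0)) (h p)"
    using cylinder_homotopy_exists[of n] by blast
  have h': "singular_chain p (cylinder (p - Suc 0)) (h (p - Suc 0))" if "p > 0"
    using h(1)[of "p - Suc 0"] that by simp
  note sz = closure_chain_imp_singular_chain[OF z(1)]
  let ?G = "case_prod \<Gamma>"
  have bd: "chain_boundary (Suc p) (cylinder_sweep p (h p) z) = cylinder_top n p z - cylinder_bottom p z"
    using chain_boundary_cylinder_sweep[OF h(1) h' h(2) sz] by (simp add: z(2))
  have push: "chain_map p ?G (chain_map p (\<lambda>x. (x, t)) y) = chain_map p (\<lambda>x. \<Gamma> x t) y" for t y
    by (simp add: chain_map_chain_map)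
  show thesis
  proof
    have "closure_chain (Suc p) Y d R
            (chain_map (Suc p) ?G (chain_map (Suc p) (map_prod f id) (h p)))"
      if f: "closure_singular_simplex p X c f" "f ` standard_simplex p \<subseteq> S" for f
    proof -
      have eq: "(\<lambda>u. ?G (map_prod f id u)) = (\<lambda>(x, t). \<Gamma> (f x) t)"
        by auto
      show ?thesis
        unfolding chain_map_chain_map eq
        by (rule closure_chain_push[OF h(1)]) (use \<Gamma>[OF f] in blast)+
    qed
    then have "closure_chain (Suc p) Y d R
        (frag_extend (\<lambda>f. chain_map (Suc p) ?G (chain_map (Suc p) (map_prod f id) (h p))) z)"
      by (rule closure_chain_extend[OF z(1)])
    moreover have "frag_extend (\<lambda>f. chain_map (Suc p) ?G (chain_map (Suc p) (map_prod f id) (h p))) z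
        = chain_map (Suc p) ?G (cylinder_sweep p (h p) z)"
      using subset_UNIV
      by (induction z rule: frag_induction)
         (simp_all add: cylinder_sweep_def frag_extend_diff chain_map_diff id_def)
    ultimately show "closure_chain (Suc p) Y d R (chain_map (Suc p) ?G (cylinder_sweep p (h p) z))"
      by simp
    show "chain_boundary (Suc p) (chain_map (Suc p) ?G (cylinder_sweep p (h p) z))
           = chain_map p (\<lambda>x. \<Gamma> x 1) ((singular_subdivision p ^^ n) z) - chain_map p (\<lambda>x. \<Gamma> x 0) z"
      using chain_boundary_chain_map[OF singular_chain_cylinder_sweep[OF h(1) sz], of ?G]
      by (simp add: bd chain_map_diff cylinder_top_def cylinder_bottom_def push)
  qed
qed

text \<open>
  This is the constant homotopy.
\<close>

lemma subdivided_cycle_homologous: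
  assumes z: "closure_chain p X c S z" "chain_boundary p z = 0"
  obtains w where "closure_chain (Suc p) X c S w"
    and "chain_boundary (Suc p) w = (singular_subdivision p ^^ n) z - z"
proof -
  have "cont_into (cylinder p) X c (\<lambda>(x, t). f x) \<and>
        (\<lambda>(x, t). f x) ` topspace (cylinder p) \<subseteq> S"
    if "closure_singular_simplex p X c f" "f ` standard_simplex p \<subseteq> S" for f
  proof -
    have "cont_into (cylinder p) X c (f \<circ> fst)"
      using that by (intro cont_into_compose[OF continuous_map_fst])
        (simp add: closure_singular_simplex_iff)
    moreover have eq: "(\<lambda>(x, t). f x) = f \<circ> fst"
      by auto
    ultimately show ?thesis
      unfolding eq using that(2) by auto
  qed
  then obtain w where w: "closure_chain (Suc p) X c S w"
    "chain_boundary (Suc p) w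
       = chain_map p (\<lambda>x. x) ((singular_subdivision p ^^ n) z) - chain_map p (\<lambda>x. x) z"
    using homologous_by_homotopy[of p X c S X c "\<lambda>x t. x" S z n] z by blast
  have "chain_map p (\<lambda>x. x) y = y" if "closure_chain p X c S y" for y
    using chain_map_ident[OF closure_chain_imp_singular_chain[OF that]] by (simp add: id_def)
  then show thesis
    using that w z(1) closure_chain_iterated_subdivision[OF z(1)] by simp
qed

section \<open>The suspension\<close>

text \<open>
  The explicit relation is an equivalence, and it lies in every equivalence containing the
  generators since its off-diagonal pairs are generators.
\<close>

lemma suspension_rel_iff:
  "(p, q) \<in> suspension_rel X \<longleftrightarrow>
     p \<in> X \<times> unit_interval \<and> q \<in> X \<times> unit_interval \<and>
     (p = q \<or> snd p = snd q \<and> snd p \<in> {0, 1})"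
proof -
  define E where "E = {(p, q). p \<in> X \<times> unit_interval \<and> q \<in> X \<times> unit_interval \<and>
     (p = q \<or> snd p = snd q \<and> snd p \<in> {0, 1})}"
  let ?g = "{((x, 0::real), (y, 0)) | x y. x \<in> X \<and> y \<in> X}
              \<union> {((x, 1::real), (y, 1)) | x y. x \<in> X \<and> y \<in> X}"
  have "equiv (X \<times> unit_interval) E"
    by (rule equivI) (auto simp: E_def refl_on_def sym_def trans_def)
  moreover have "?g \<subseteq> E"
    by (auto simp: E_def)
  moreover have "E \<subseteq> r" if r: "equiv (X \<times> unit_interval) r" "?g \<subseteq> r" for r
  proof
    fix u
    assume "u \<in> E"
    then obtain p q where u: "u = (p, q)" "p \<in> X \<times> unit_interval" "q \<in> X \<times> unit_interval"
        "p = q \<or> snd p = snd q \<and> snd p \<in> {0, 1}"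
      by (auto simp: E_def)
    show "u \<in> r"
    proof (cases "p = q")
      case True
      then show ?thesis
        using r(1) u by (auto simp: equiv_def refl_on_def)
    next
      case False
      then have "u \<in> ?g"
        using u by (cases p; cases q) auto
      then show ?thesis
        using r(2) by blast
    qed
  qed
  ultimately have "suspension_rel X = E"
    unfolding suspension_rel_def generated_equiv_def
    by (intro equalityI Inter_lower Inter_greatest) simp_all
  then show ?thesis
    by (simp add: E_def)
qed

lemma equiv_suspension_rel: "equiv (X \<times> unit_interval) (suspension_rel X)"
  by (rule equivI) (auto simp: refl_on_def sym_def trans_def suspension_rel_iff)

lemma suspension_proj_eq_iff:
  assumes "x \<in> X" "t \<in> unit_interval" "y \<in> X" "s \<in> unit_interval"
  shows "suspension_proj X (x, t) = suspension_proj X (y, s) \<longleftrightarrow>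
           t = s \<and> (x = y \<or> t = 0 \<or> t = 1)"
  using assms eq_equiv_class_iff[OF equiv_suspension_rel, of "(x, t)" X "(y, s)"]
  by (auto simp: suspension_proj_def suspension_rel_iff)

lemma suspension_apex:
  "x \<in> X \<Longrightarrow> y \<in> X \<Longrightarrow> e \<in> {0, 1} \<Longrightarrow> suspension_proj X (x, e) = suspension_proj X (y, e)"
  using suspension_proj_eq_iff[of x X e y e] by auto

lemma suspension_space_eq: "suspension_space X = suspension_proj X ` (X \<times> unit_interval)"
  by (auto simp: suspension_space_def suspension_proj_def quotient_def)

lemma suspension_proj_in [simp]:
  "x \<in> X \<Longrightarrow> t \<in> unit_interval \<Longrightarrow> suspension_proj X (x, t) \<in> suspension_space X"
  by (auto simp: suspension_space_eq)

text \<open>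
  Heights are determined by the point of the suspension.  The base point is determined only for
  heights strictly between 0 and 1; at the two apices it is an arbitrary point of \<open>X\<close>.
\<close>

definition suspension_rep :: "'a set \<Rightarrow> ('a \<times> real) set \<Rightarrow> 'a \<times> real" where
  "suspension_rep X P = (SOME p. p \<in> X \<times> unit_interval \<and> suspension_proj X p = P)"

definition height :: "'a set \<Rightarrow> ('a \<times> real) set \<Rightarrow> real" where
  "height X P = snd (suspension_rep X P)"

definition base_point :: "'a set \<Rightarrow> ('a \<times> real) set \<Rightarrow> 'a" where
  "base_point X P = fst (suspension_rep X P)"

lemma suspension_rep:
  assumes "P \<in> suspension_space X"
  shows "base_point X P \<in> X" "0 \<le> height X P" "height X P \<le> 1"
    "suspension_proj X (base_point X P, height X P) = P"
proof -
  have "suspension_rep X P \<in> X \<times> unit_interval \<and> suspension_proj X (suspension_rep X P) = P"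
    unfolding suspension_rep_def by (rule someI_ex) (use assms[unfolded suspension_space_eq] in blast)
  then show "base_point X P \<in> X" "0 \<le> height X P" "height X P \<le> 1"
    "suspension_proj X (base_point X P, height X P) = P"
    by (auto simp: base_point_def height_def mem_Times_iff)
qed

lemma height_proj:
  assumes "x \<in> X" "t \<in> unit_interval"
  shows "height X (suspension_proj X (x, t)) = t"
proof -
  let ?P = "suspension_proj X (x, t)"
  have "?P \<in> suspension_space X"
    using assms by simp
  from suspension_rep[OF this] show ?thesis
    using suspension_proj_eq_iff[of "base_point X ?P" X "height X ?P" x t] assms by auto
qed

lemma base_point_proj:
  assumes "x \<in> X" "0 < t" "t < 1"
  shows "base_point X (suspension_proj X (x, t)) = x"
proof -
  let ?P = "suspension_proj X (x, t)"
  have "?P \<in> suspension_space X"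
    using assms by simp
  from suspension_rep[OF this] show ?thesis
    using suspension_proj_eq_iff[of "base_point X ?P" X "height X ?P" x t] assms by auto
qed

lemma unit_interval_nhd_iff:
  assumes t: "t \<in> unit_interval"
  shows "closure_nhd unit_interval unit_interval_closure t V \<longleftrightarrow>
           V \<subseteq> unit_interval \<and> (\<exists>\<epsilon>>0. \<forall>s\<in>unit_interval. \<bar>s - t\<bar> < \<epsilon> \<longrightarrow> s \<in> V)"
proof -
  have "t \<notin> unit_interval_closure (unit_interval - V) \<longleftrightarrow>
          (\<exists>\<epsilon>>0. \<forall>s\<in>unit_interval. \<bar>s - t\<bar> < \<epsilon> \<longrightarrow> s \<in> V)" (is "?l \<longleftrightarrow> ?r")
  proof
    assume ?l
    then obtain T where T: "openin (top_of_set unit_interval) T" "t \<in> T" "T \<inter> (unit_interval - V) = {}"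
      using t unfolding in_closure_of topspace_euclidean_subtopology by blast
    then obtain e where "e > 0" "ball t e \<inter> unit_interval \<subseteq> T"
      by (meson openin_contains_ball)
    moreover have "s \<in> ball t e" if "\<bar>s - t\<bar> < e" for s
      using that by (simp add: dist_real_def abs_minus_commute)
    ultimately show ?r
      using T(3) by blast
  next
    assume ?r
    then obtain e where e: "e > 0" "\<forall>s\<in>unit_interval. \<bar>s - t\<bar> < e \<longrightarrow> s \<in> V"
      by blast
    have "openin (top_of_set unit_interval) (unit_interval \<inter> ball t e)"
      by (intro openin_open_Int) simp
    moreover have "unit_interval \<inter> ball t e \<inter> (unit_interval - V) = {}"
      using e(2) by (auto simp: dist_real_def abs_minus_commute)
    moreover have "t \<in> unit_interval \<inter> ball t e"
      using t e(1) by simp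
    ultimately show ?l
      unfolding in_closure_of by blast
  qed
  then show ?thesis
    using t by (auto simp: closure_nhd_def closure_interior_def)
qed

lemma notin_image_Times_iff:
  "C \<subseteq> A \<times> B \<Longrightarrow> P \<notin> q ` C \<longleftrightarrow> (\<forall>x\<in>A. \<forall>t\<in>B. q (x, t) = P \<longrightarrow> (x, t) \<notin> C)"
  by blast

text \<open>
  For the quotient closure, a point lies in the interior of \<open>W\<close> if and only if every one of its
  representatives lies in the interior of the preimage of \<open>W\<close>.  At an apex the size of the
  neighbourhood may vary with \<open>x\<close>.
\<close>

lemma suspension_nhd_iff:
  assumes W: "W \<subseteq> suspension_space X"
  shows "closure_nhd (suspension_space X) (suspension_closure X c) P W \<longleftrightarrow>
     P \<in> suspension_space X \<and>
     (\<forall>x\<in>X. \<forall>t\<in>unit_interval. suspension_proj X (x, t) = P \<longrightarrow>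
        (\<exists>U \<epsilon>. closure_nhd X c x U \<and> \<epsilon> > 0 \<and>
           (\<forall>x'\<in>U. \<forall>t'\<in>unit_interval. \<bar>t' - t\<bar> < \<epsilon> \<longrightarrow> suspension_proj X (x', t') \<in> W)))"
proof -
  let ?S = "{p \<in> X \<times> unit_interval. suspension_proj X p \<in> suspension_space X - W}"
  let ?cl = "prod_closure X c unit_interval unit_interval_closure ?S"
  have key: "(x, t) \<notin> ?cl \<longleftrightarrow> (\<exists>U \<epsilon>. closure_nhd X c x U \<and> \<epsilon> > 0 \<and>
           (\<forall>x'\<in>U. \<forall>t'\<in>unit_interval. \<bar>t' - t\<bar> < \<epsilon> \<longrightarrow> suspension_proj X (x', t') \<in> W))"
    if x: "x \<in> X" and t: "t \<in> unit_interval" for x t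
  proof
    assume "(x, t) \<notin> ?cl"
    then obtain U V where UV: "closure_nhd X c x U"
        "closure_nhd unit_interval unit_interval_closure t V" "U \<times> V \<inter> ?S = {}"
      using x t by (auto simp: prod_closure_def)
    then have U: "U \<subseteq> X" by (simp add: closure_nhd_def)
    obtain \<epsilon> where e: "\<epsilon> > 0" "\<forall>s\<in>unit_interval. \<bar>s - t\<bar> < \<epsilon> \<longrightarrow> s \<in> V"
      using UV(2) unit_interval_nhd_iff[OF t] by blast
    have "suspension_proj X (x', t') \<in> W"
      if "x' \<in> U" "t' \<in> unit_interval" "\<bar>t' - t\<bar> < \<epsilon>" for x' t'
    proof -
      have "(x', t') \<notin> ?S"
        using UV(3) e that by blast
      then show ?thesis
        using that U by auto
    qed
    then show "\<exists>U \<epsilon>. closure_nhd X c x U \<and> \<epsilon> > 0 \<and>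
           (\<forall>x'\<in>U. \<forall>t'\<in>unit_interval. \<bar>t' - t\<bar> < \<epsilon> \<longrightarrow> suspension_proj X (x', t') \<in> W)"
      using UV(1) e(1) by blast
  next
    assume "\<exists>U \<epsilon>. closure_nhd X c x U \<and> \<epsilon> > 0 \<and>
           (\<forall>x'\<in>U. \<forall>t'\<in>unit_interval. \<bar>t' - t\<bar> < \<epsilon> \<longrightarrow> suspension_proj X (x', t') \<in> W)"
    then obtain U \<epsilon> where U: "closure_nhd X c x U" "\<epsilon> > 0"
      "\<forall>x'\<in>U. \<forall>t'\<in>unit_interval. \<bar>t' - t\<bar> < \<epsilon> \<longrightarrow> suspension_proj X (x', t') \<in> W"
      by blast
    let ?V = "{s \<in> unit_interval. \<bar>s - t\<bar> < \<epsilon>}"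
    have "closure_nhd unit_interval unit_interval_closure t ?V"
      unfolding unit_interval_nhd_iff[OF t] using U(2) by auto
    moreover have "U \<times> ?V \<inter> ?S = {}"
      using U(3) by auto
    ultimately show "(x, t) \<notin> ?cl"
      using U(1) unfolding prod_closure_def by blast
  qed
  have "?cl \<subseteq> X \<times> unit_interval"
    by (auto simp: prod_closure_def)
  then have "P \<notin> suspension_proj X ` ?cl \<longleftrightarrow>
          (\<forall>x\<in>X. \<forall>t\<in>unit_interval. suspension_proj X (x, t) = P \<longrightarrow> (x, t) \<notin> ?cl)"
    using notin_image_Times_iff[of ?cl X unit_interval P "suspension_proj X"] by blast
  then have "P \<notin> suspension_closure X c (suspension_space X - W) \<longleftrightarrow>
          (\<forall>x\<in>X. \<forall>t\<in>unit_interval. suspension_proj X (x, t) = P \<longrightarrow> (x, t) \<notin> ?cl)"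
    by (simp only: suspension_closure_def)
  then show ?thesis
    unfolding closure_nhd_def[of "suspension_space X"] closure_interior_def
    using W key by (auto simp del: atLeastAtMost_iff)
qed

lemma suspension_closure_mono:
  "A \<subseteq> B \<Longrightarrow> B \<subseteq> suspension_space X \<Longrightarrow> suspension_closure X c A \<subseteq> suspension_closure X c B"
  unfolding suspension_closure_def prod_closure_def by (intro image_mono) blast

lemma cont_into_suspension_nhdD:
  assumes f: "cont_into T (suspension_space X) (suspension_closure X c) f" and y: "y \<in> topspace T"
    and W: "W \<subseteq> suspension_space X"
    and nhd: "\<And>x t. x \<in> X \<Longrightarrow> t \<in> unit_interval \<Longrightarrow> suspension_proj X (x, t) = f y \<Longrightarrow>
        \<exists>U \<epsilon>. closure_nhd X c x U \<and> \<epsilon> > 0 \<and>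
           (\<forall>x'\<in>U. \<forall>t'\<in>unit_interval. \<bar>t' - t\<bar> < \<epsilon> \<longrightarrow> suspension_proj X (x', t') \<in> W)"
  obtains V where "openin T V" "y \<in> V" "f ` V \<subseteq> W"
proof (rule cont_into_nhdD[OF suspension_closure_mono f y])
  have "f y \<in> suspension_space X"
    using f y by (auto simp: closure_continuous_def)
  then show "closure_nhd (suspension_space X) (suspension_closure X c) (f y) W"
    using nhd by (simp add: suspension_nhd_iff[OF W])
qed (use that in auto)

text \<open>
  Away from the apices, the simplices and homotopies constructed below consist of a map to \<open>X\<close> and
  a height in this way.
\<close>

lemma cont_into_suspension_proj:
  assumes X: "closure_space X c" and f: "cont_into T X c f"
    and r: "continuous_map T (top_of_set unit_interval) r"
  shows "cont_into T (suspension_space X) (suspension_closure X c) (\<lambda>y. suspension_proj X (f y, r y))"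
proof (rule cont_into_nhdI)
  have fX: "f y \<in> X" if "y \<in> topspace T" for y
    using f that unfolding closure_continuous_def by blast
  have rI: "r y \<in> unit_interval" if "y \<in> topspace T" for y
    using continuous_map_image_subset_topspace[OF r] that by auto
  from fX rI show "(\<lambda>y. suspension_proj X (f y, r y)) ` topspace T \<subseteq> suspension_space X"
    by auto
  fix y W
  assume y: "y \<in> topspace T" and
    W: "closure_nhd (suspension_space X) (suspension_closure X c) (suspension_proj X (f y, r y)) W"
  have "W \<subseteq> suspension_space X"
    using W by (simp add: closure_nhd_def)
  from W[unfolded suspension_nhd_iff[OF this]] fX[OF y] rI[OF y]
  obtain U \<epsilon> where U: "closure_nhd X c (f y) U" "\<epsilon> > 0"
    "\<forall>x'\<in>U. \<forall>t'\<in>unit_interval. \<bar>t' - r y\<bar> < \<epsilon> \<longrightarrow> suspension_proj X (x', t') \<in> W"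
    by blast
  obtain V where V: "openin T V" "y \<in> V" "f ` V \<subseteq> U"
    by (rule cont_into_nhdD[OF closure_space_mono[OF X] f y U(1)])
  let ?V' = "{z \<in> topspace T. r z \<in> ball (r y) \<epsilon>}"
  have "openin T ?V'"
    by (rule openin_continuous_map_preimage[OF continuous_map_into_fulltopology[OF r]]) simp
  moreover have "(\<lambda>y. suspension_proj X (f y, r y)) ` (V \<inter> ?V') \<subseteq> W"
    using U(3) V(3) rI by (force simp: dist_real_def abs_minus_commute)
  ultimately show "\<exists>V. openin T V \<and> y \<in> V \<and> (\<lambda>y. suspension_proj X (f y, r y)) ` V \<subseteq> W"
    using V U(2) y by (intro exI[of _ "V \<inter> ?V'"]) auto
qed

lemma closure_nhd_carrier:
  "closure_space X c \<Longrightarrow> x \<in> X \<Longrightarrow> closure_nhd X c x X"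
  by (simp add: closure_nhd_def closure_interior_def closure_space_def)

lemma continuous_map_height:
  assumes X: "closure_space X c"
    and f: "cont_into T (suspension_space X) (suspension_closure X c) f"
  shows "continuous_map T euclideanreal (\<lambda>y. height X (f y))"
proof -
  have "\<exists>V. openin T V \<and> y \<in> V \<and> (\<forall>z\<in>V. height X (f z) \<in> ball (height X (f y)) \<epsilon>)"
    if y: "y \<in> topspace T" and e: "\<epsilon> > 0" for y \<epsilon>
  proof -
    let ?W = "{P \<in> suspension_space X. height X P \<in> ball (height X (f y)) \<epsilon>}"
    have nhd: "\<exists>U \<epsilon>'. closure_nhd X c x U \<and> \<epsilon>' > 0 \<and>
           (\<forall>x'\<in>U. \<forall>t'\<in>unit_interval. \<bar>t' - t\<bar> < \<epsilon>' \<longrightarrow> suspension_proj X (x', t') \<in> ?W)"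
      if xt: "x \<in> X" "t \<in> unit_interval" "suspension_proj X (x, t) = f y" for x t
    proof (intro exI conjI ballI impI)
      have "height X (f y) = t"
        using height_proj[OF xt(1,2)] xt(3) by simp
      then show "suspension_proj X (x', t') \<in> ?W"
        if "x' \<in> X" "t' \<in> unit_interval" "\<bar>t' - t\<bar> < \<epsilon>" for x' t'
        using that by (simp add: height_proj dist_real_def abs_minus_commute del: atLeastAtMost_iff)
    qed (use e closure_nhd_carrier[OF X xt(1)] in auto)
    obtain V where "openin T V" "y \<in> V" "f ` V \<subseteq> ?W"
      by (rule cont_into_suspension_nhdD[OF f y _ nhd]) auto
    then show ?thesis
      by blast
  qed
  note nhds = this
  have "openin T {y \<in> topspace T. height X (f y) \<in> U}" if "open U" for U
  proof (subst openin_subopen, intro ballI)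
    fix y
    assume "y \<in> {y \<in> topspace T. height X (f y) \<in> U}"
    then have y: "y \<in> topspace T" "height X (f y) \<in> U"
      by auto
    then obtain \<epsilon> where e: "\<epsilon> > 0" "ball (height X (f y)) \<epsilon> \<subseteq> U"
      using openE[OF \<open>open U\<close>] by metis
    obtain V where V: "openin T V" "y \<in> V" "\<And>z. z \<in> V \<Longrightarrow> height X (f z) \<in> ball (height X (f y)) \<epsilon>"
      using nhds[OF y(1) e(1)] by blast
    have "V \<subseteq> {y \<in> topspace T. height X (f y) \<in> U}"
      using V(3) e(2) openin_subset[OF V(1)] by blast
    with V show "\<exists>V. openin T V \<and> y \<in> V \<and> V \<subseteq> {y \<in> topspace T. height X (f y) \<in> U}"
      by blast
  qed
  then show ?thesis
    by (simp add: continuous_map_def)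
qed

text \<open>
  For \<open>e \<in> {0, 1}\<close> this is the cone around the apex at height \<open>e\<close>: only the opposite apex is
  removed.
\<close>

definition punctured :: "'a set \<Rightarrow> real \<Rightarrow> ('a \<times> real) set set" where
  "punctured X e = {P \<in> suspension_space X. height X P \<noteq> 1 - e}"

abbreviation waist :: "'a set \<Rightarrow> ('a \<times> real) set set" where
  "waist X \<equiv> punctured X 0 \<inter> punctured X 1"

lemma waist_eq:
  "waist X = {P \<in> suspension_space X. 0 < height X P \<and> height X P < 1}"
  using suspension_rep(2,3)[of _ X] by (auto simp: punctured_def order_less_le)

text \<open>
  The cylinder \<open>A \<times> [0, 1]\<close> over a neighbourhood \<open>A\<close> projects to a neighbourhood of every point
  over \<open>A\<close> of height strictly between 0 and 1, because such a point has only one representative.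
\<close>

lemma cont_into_base_point:
  assumes X: "closure_space X c"
    and f: "cont_into T (suspension_space X) (suspension_closure X c) f"
    and mid: "f ` topspace T \<subseteq> waist X"
  shows "cont_into T X c (\<lambda>y. base_point X (f y))"
proof (rule cont_into_nhdI)
  have fy: "f y \<in> suspension_space X" "0 < height X (f y)" "height X (f y) < 1"
    if "y \<in> topspace T" for y
    using mid that unfolding waist_eq by auto
  then show "(\<lambda>y. base_point X (f y)) ` topspace T \<subseteq> X"
    using suspension_rep(1)[of _ X] by blast
  fix y A
  assume y: "y \<in> topspace T" and A: "closure_nhd X c (base_point X (f y)) A"
  have AX: "A \<subseteq> X"
    using A by (simp add: closure_nhd_def)
  let ?W = "suspension_proj X ` (A \<times> unit_interval)"
  have nhd: "\<exists>U \<epsilon>'. closure_nhd X c x U \<and> \<epsilon>' > 0 \<and>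
           (\<forall>x'\<in>U. \<forall>t'\<in>unit_interval. \<bar>t' - t\<bar> < \<epsilon>' \<longrightarrow> suspension_proj X (x', t') \<in> ?W)"
      if xt: "x \<in> X" "t \<in> unit_interval" "suspension_proj X (x, t) = f y" for x t
  proof (intro exI conjI ballI impI)
    have t: "height X (f y) = t"
      using height_proj[OF xt(1,2)] xt(3) by simp
    have "base_point X (f y) = x"
      using base_point_proj[of x X t] fy[OF y] xt t by simp
    then show "closure_nhd X c x A"
      using A by simp
    show "(1::real) > 0" by simp
  qed auto
  have WX: "?W \<subseteq> suspension_space X"
    using AX by (auto simp: suspension_space_eq)
  obtain V where V: "openin T V" "y \<in> V" "f ` V \<subseteq> ?W"
    by (rule cont_into_suspension_nhdD[OF f y WX nhd])
  have "base_point X (f z) \<in> A" if z: "z \<in> V" for z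
  proof -
    have zT: "z \<in> topspace T"
      using z V(1) openin_subset by blast
    obtain x t where xt: "x \<in> A" "t \<in> unit_interval" "f z = suspension_proj X (x, t)"
      using V(3) z by auto
    then have "0 < t \<and> t < 1"
      using fy[OF zT] height_proj[of x X t] AX by auto
    then show ?thesis
      using base_point_proj[of x X t] xt AX by auto
  qed
  then show "\<exists>V. openin T V \<and> y \<in> V \<and> (\<lambda>y. base_point X (f y)) ` V \<subseteq> A"
    using V by blast
qed

text \<open>
  The linear contraction of heights towards \<open>e\<close>, which reaches the apex at time 1.
\<close>

definition contract :: "'a set \<Rightarrow> real \<Rightarrow> ('a \<times> real) set \<Rightarrow> real \<Rightarrow> ('a \<times> real) set" where
  "contract X e P s = suspension_proj X (base_point X P, e + (1 - s) * (height X P - e))"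

lemma contract_height_bounds:
  assumes "e \<in> {0, 1}" "s \<in> unit_interval" "t \<in> unit_interval"
  shows "e + (1 - s) * (t - e) \<in> unit_interval" "\<bar>(1 - s) * (t - e)\<bar> \<le> \<bar>t - e\<bar>"
proof -
  have "\<bar>1 - s\<bar> * \<bar>t - e\<bar> \<le> 1 * \<bar>t - e\<bar>"
    using assms by (intro mult_right_mono) auto
  then show "\<bar>(1 - s) * (t - e)\<bar> \<le> \<bar>t - e\<bar>"
    by (simp add: abs_mult)
  have "0 \<le> (1 - s) * t" "(1 - s) * t \<le> 1" "0 \<le> (1 - s) * (1 - t)" "(1 - s) * (1 - t) \<le> 1"
    using assms by (auto intro: mult_le_one)
  then show "e + (1 - s) * (t - e) \<in> unit_interval"
    using assms(1) by (auto simp: algebra_simps)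
qed

lemma contract_0: "P \<in> suspension_space X \<Longrightarrow> contract X e P 0 = P"
  by (simp add: contract_def suspension_rep(4))

lemma contract_in_punctured:
  assumes "e \<in> {0, 1}" "s \<in> unit_interval" "P \<in> punctured X e"
  shows "contract X e P s \<in> punctured X e"
proof -
  have P: "P \<in> suspension_space X" "height X P \<noteq> 1 - e"
    using assms by (auto simp: punctured_def)
  note h = suspension_rep[OF P(1)]
  have hI: "height X P \<in> unit_interval" using h by simp
  note b = contract_height_bounds[OF assms(1,2) hI]
  have "\<bar>height X P - e\<bar> < 1"
    using P(2) h(2,3) assms(1) by auto
  then have "e + (1 - s) * (height X P - e) \<noteq> 1 - e"
    using b(2) assms(1) by auto
  then show ?thesis
    using h(1) b(1) by (simp add: punctured_def contract_def height_proj del: atLeastAtMost_iff)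
qed

text \<open>
  Contracting a simplex in a cone is continuous although the corresponding map on the product of
  the cone with the interval is a map out of a quotient.  Away from the apex it is given by a base
  point and a height.  At the apex it is continuous because a neighbourhood contains a union of sets
  \<open>U x \<times> {t. \<bar>t - e\<bar> < \<epsilon> x}\<close>, which is itself a neighbourhood and is mapped into itself at all
  times.
\<close>

lemma cont_into_contract:
  assumes X: "closure_space X c" and e: "e \<in> {0, 1}"
    and f: "cont_into T (suspension_space X) (suspension_closure X c) f"
    and fe: "f ` topspace T \<subseteq> punctured X e"
  shows "cont_into (prod_topology T (top_of_set unit_interval))
           (suspension_space X) (suspension_closure X c) (\<lambda>(y, s). contract X e (f y) s)"
    (is "cont_into ?T _ _ ?g")
proof (rule cont_into_nhdI)
  have ge: "?g ` topspace ?T \<subseteq> punctured X e"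
    using fe contract_in_punctured[OF e] by fastforce
  then show "?g ` topspace ?T \<subseteq> suspension_space X"
    by (auto simp: punctured_def)
  fix z W
  assume z: "z \<in> topspace ?T" and
    W: "closure_nhd (suspension_space X) (suspension_closure X c) (?g z) W"
  have WX: "W \<subseteq> suspension_space X"
    using W by (simp add: closure_nhd_def)
  obtain y s where ys: "z = (y, s)" "y \<in> topspace T" "s \<in> unit_interval"
    using z by auto
  have fX: "f y \<in> suspension_space X" if "y \<in> topspace T" for y
    using fe that by (auto simp: punctured_def)
  show "\<exists>V. openin ?T V \<and> z \<in> V \<and> ?g ` V \<subseteq> W"
  proof (cases "height X (f y) = e")
    case False
    \<comment> \<open>On the open set \<open>Q\<close> all points have a well-defined base point.\<close>
    define Q where "Q = {y \<in> topspace T. height X (f y) \<in> - {e}}"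
    have Q: "openin T Q"
      unfolding Q_def
      by (rule openin_continuous_map_preimage[OF continuous_map_height[OF X f]]) auto
    let ?T' = "prod_topology (subtopology T Q) (top_of_set unit_interval)"
    have T': "?T' = subtopology ?T (Q \<times> UNIV)"
      by (simp add: subtopology_Times)
    have QT: "openin ?T (Q \<times> unit_interval)"
      using Q by (auto simp: openin_prod_Times_iff)
    have fQ: "cont_into ?T' (suspension_space X) (suspension_closure X c) (f \<circ> fst)"
      by (rule cont_into_compose[OF continuous_map_into_fulltopology[OF continuous_map_fst] f])
    have "(f \<circ> fst) ` topspace ?T' \<subseteq> waist X"
      using fe e by (auto simp: Q_def punctured_def)
    note base = cont_into_base_point[OF X fQ this]
    have r: "continuous_map ?T' (top_of_set unit_interval)
               (\<lambda>u. e + (1 - snd u) * (height X ((f \<circ> fst) u) - e))"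
      unfolding continuous_map_in_subtopology
    proof
      show "continuous_map ?T' euclideanreal (\<lambda>u. e + (1 - snd u) * (height X ((f \<circ> fst) u) - e))"
        using continuous_map_height[OF X fQ]
          continuous_map_into_fulltopology[OF continuous_map_snd[of "subtopology T Q" "top_of_set unit_interval"]]
        by (intro continuous_map_add continuous_map_real_mult continuous_map_diff) auto
      show "(\<lambda>u. e + (1 - snd u) * (height X ((f \<circ> fst) u) - e)) \<in> topspace ?T' \<rightarrow> unit_interval"
        using contract_height_bounds(1)[OF e] suspension_rep(2,3)[OF fX] by fastforce
    qed
    have g: "cont_into ?T' (suspension_space X) (suspension_closure X c) ?g"
      using cont_into_suspension_proj[OF X base r]
      by (simp add: contract_def case_prod_unfold)
    have zT': "z \<in> topspace ?T'"
      using ys False by (auto simp: Q_def)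
    obtain V where V: "openin ?T' V" "z \<in> V" "?g ` V \<subseteq> W"
      by (rule cont_into_nhdD[OF suspension_closure_mono g zT' W])
    have "openin ?T V"
    proof -
      have "?T' = subtopology ?T (topspace ?T \<inter> Q \<times> UNIV)"
        by (simp only: T' subtopology_restrict)
      moreover have "topspace ?T \<inter> Q \<times> UNIV = Q \<times> unit_interval"
        by (auto simp: Q_def)
      ultimately show ?thesis
        using V(1) QT openin_trans_full by metis
    qed
    then show ?thesis
      using V by blast
  next
    case True
    have apex: "?g z = suspension_proj X (x, e)" if "x \<in> X" for x
      using suspension_apex[OF suspension_rep(1)[OF fX[OF ys(2)]] that e] True
      by (simp add: ys(1) contract_def)
    have "\<forall>x\<in>X. \<exists>U \<epsilon>. closure_nhd X c x U \<and> \<epsilon> > 0 \<and>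
           (\<forall>x'\<in>U. \<forall>t'\<in>unit_interval. \<bar>t' - e\<bar> < \<epsilon> \<longrightarrow> suspension_proj X (x', t') \<in> W)"
    proof
      fix x
      assume x: "x \<in> X"
      have eI: "e \<in> unit_interval"
        using e by auto
      show "\<exists>U \<epsilon>. closure_nhd X c x U \<and> \<epsilon> > 0 \<and>
           (\<forall>x'\<in>U. \<forall>t'\<in>unit_interval. \<bar>t' - e\<bar> < \<epsilon> \<longrightarrow> suspension_proj X (x', t') \<in> W)"
        using W[unfolded suspension_nhd_iff[OF WX], THEN conjunct2, rule_format, OF x eI apex[OF x, symmetric]] .
    qed
    then obtain U \<epsilon> where U: "\<And>x. x \<in> X \<Longrightarrow> closure_nhd X c x (U x)" "\<And>x. x \<in> X \<Longrightarrow> \<epsilon> x > (0::real)"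
      "\<And>x x' t'. x \<in> X \<Longrightarrow> x' \<in> U x \<Longrightarrow> t' \<in> unit_interval \<Longrightarrow> \<bar>t' - e\<bar> < \<epsilon> x \<Longrightarrow>
          suspension_proj X (x', t') \<in> W"
      by metis
    have UX: "U x \<subseteq> X" if "x \<in> X" for x
      using U(1)[OF that] by (simp add: closure_nhd_def)
    \<comment> \<open>A neighbourhood of the apex inside \<open>W\<close> that the contraction maps into itself.\<close>
    define W' where "W' = {suspension_proj X (x', t') | x x' t'.
        x \<in> X \<and> x' \<in> U x \<and> t' \<in> unit_interval \<and> \<bar>t' - e\<bar> < \<epsilon> x}"
    have nhd: "\<exists>U' \<epsilon>'. closure_nhd X c x U' \<and> \<epsilon>' > 0 \<and>
           (\<forall>x'\<in>U'. \<forall>t'\<in>unit_interval. \<bar>t' - t\<bar> < \<epsilon>' \<longrightarrow> suspension_proj X (x', t') \<in> W')"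
      if xt: "x \<in> X" "t \<in> unit_interval" "suspension_proj X (x, t) = f y" for x t
    proof -
      have "t = e"
        using height_proj[OF xt(1,2)] xt(3) True by simp
      then show ?thesis
        using U(1,2)[OF xt(1)] xt(1) unfolding W'_def by blast
    qed
    have W'X: "W' \<subseteq> suspension_space X"
      unfolding W'_def suspension_space_eq using UX by blast
    obtain V where V: "openin T V" "y \<in> V" "f ` V \<subseteq> W'"
      by (rule cont_into_suspension_nhdD[OF f ys(2) W'X nhd])
    have "contract X e (f v) r \<in> W" if v: "v \<in> V" and r: "r \<in> unit_interval" for v r
    proof -
      obtain x x' t' where x: "x \<in> X" "x' \<in> U x" "t' \<in> unit_interval" "\<bar>t' - e\<bar> < \<epsilon> x"
          "f v = suspension_proj X (x', t')"
        using V(3) v unfolding W'_def by blast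
      have x': "x' \<in> X"
        using UX x by blast
      have h: "height X (f v) = t'"
        using height_proj[OF x' x(3)] x(5) by simp
      have vT: "v \<in> topspace T"
        using v V(1) openin_subset by blast
      note b = contract_height_bounds[OF e r x(3)]
      have "suspension_proj X (x', e + (1 - r) * (t' - e)) \<in> W"
        by (rule U(3)[OF x(1,2) b(1)]) (use b(2) x(4) in auto)
      moreover have "contract X e (f v) r = suspension_proj X (x', e + (1 - r) * (t' - e))"
      proof (cases "t' = e")
        case True
        then show ?thesis
          using suspension_apex[OF suspension_rep(1)[OF fX[OF vT]] x' e]
          by (simp add: contract_def h)
      next
        case False
        have "t' \<noteq> 1 - e"
          using fe vT h by (auto simp: punctured_def)
        then have "0 < t'" "t' < 1"
          using False e x(3) by auto
        then have "base_point X (f v) = x'"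
          using base_point_proj[OF x'] x(5) by simp
        then show ?thesis
          by (simp add: contract_def h)
      qed
      ultimately show ?thesis
        by simp
    qed
    then have "?g ` (V \<times> unit_interval) \<subseteq> W"
      by auto
    moreover have "openin ?T (V \<times> unit_interval)"
      using V(1) by (auto simp: openin_prod_Times_iff)
    ultimately show ?thesis
      using V(2) ys by blast
  qed
qed

section \<open>Acyclic pieces and small chains\<close>

lemma cont_into_const:
  assumes X: "closure_space X c" and x: "x \<in> X"
  shows "cont_into T X c (\<lambda>_. x)"
proof (rule cont_into_nhdI)
  fix y W
  assume y: "y \<in> topspace T" and "closure_nhd X c x W"
  then have W: "W \<subseteq> X" "x \<notin> c (X - W)"
    by (auto simp: closure_nhd_def closure_interior_def)
  have "X - W \<subseteq> c (X - W)"
    using X by (simp add: closure_space_def)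
  then have "x \<in> W"
    using W x by blast
  then show "\<exists>V. openin T V \<and> y \<in> V \<and> (\<lambda>_. x) ` V \<subseteq> W"
    using y by (intro exI[of _ "topspace T"]) auto
qed (use x in auto)

abbreviation suspension_chain ::
    "nat \<Rightarrow> 'a set \<Rightarrow> ('a set \<Rightarrow> 'a set) \<Rightarrow> ('a \<times> real) set set \<Rightarrow> ('a \<times> real) set chain \<Rightarrow> bool" where
  "suspension_chain p X c S \<equiv> closure_chain p (suspension_space X) (suspension_closure X c) S"

text \<open>
  The contraction makes a cycle in a cone homologous to its image under the constant map to the
  apex, and in positive degrees this image bounds.
\<close>

lemma punctured_cycle_imp_boundary:
  assumes X: "closure_space X c" and e: "e \<in> {0, 1}" and p: "1 \<le> p"
    and z: "suspension_chain p X c (punctured X e) z" "chain_boundary p z = 0"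
  obtains w where "suspension_chain (Suc p) X c (punctured X e) w" "chain_boundary (Suc p) w = z"
proof (cases "X = {}")
  case True
  then have "punctured X e = {}"
    by (simp add: punctured_def suspension_space_eq)
  then have "z = 0"
    using z(1) nonempty_standard_simplex[of p] by (auto simp: closure_chain_def)
  then show thesis
    using that[of 0] by simp
next
  case False
  then obtain x where x: "x \<in> X"
    by blast
  define a where "a = suspension_proj X (x, e)"
  have eI: "e \<in> unit_interval"
    using e by auto
  have a: "a \<in> punctured X e"
    using e height_proj[OF x eI] suspension_proj_in[OF x eI] by (auto simp: a_def punctured_def)
  have contr: "cont_into (cylinder p) (suspension_space X) (suspension_closure X c)
            (\<lambda>(y, t). contract X e (f y) t) \<and>
          (\<lambda>(y, t). contract X e (f y) t) ` topspace (cylinder p) \<subseteq> punctured X e"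
    if f: "closure_singular_simplex p (suspension_space X) (suspension_closure X c) f"
      "f ` standard_simplex p \<subseteq> punctured X e" for f
  proof
    show "cont_into (cylinder p) (suspension_space X) (suspension_closure X c)
            (\<lambda>(y, t). contract X e (f y) t)"
      by (rule cont_into_contract[OF X e]) (use f in \<open>auto simp: closure_singular_simplex_iff\<close>)
    show "(\<lambda>(y, t). contract X e (f y) t) ` topspace (cylinder p) \<subseteq> punctured X e"
      using f(2) contract_in_punctured[OF e] by fastforce
  qed
  obtain w where w: "suspension_chain (Suc p) X c (punctured X e) w"
    "chain_boundary (Suc p) w
       = chain_map p (\<lambda>P. contract X e P 1) ((singular_subdivision p ^^ 0) z)
         - chain_map p (\<lambda>P. contract X e P 0) z"
    by (rule homologous_by_homotopy[OF contr z])
  have "contract X e P 1 = a" if "P \<in> punctured X e" for P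
    using suspension_apex[OF suspension_rep(1) x e, of P] that
    by (simp add: contract_def a_def punctured_def)
  then have 1: "chain_map p (\<lambda>P. contract X e P 1) z = chain_map p (\<lambda>P. a) z"
    by (rule chain_map_closure_chain_cong[OF z(1)])
  have 0: "chain_map p (\<lambda>P. contract X e P 0) z = z"
    by (rule chain_map_closure_chain_id[OF z(1)]) (simp add: contract_0 punctured_def)
  let ?A = "subtopology indiscrete_topology {a}"
  have tA: "topspace ?A = {a}"
    by simp
  have "singular_relcycle p indiscrete_topology {} z"
    using closure_chain_imp_singular_chain[OF z(1)] z(2) by (simp add: singular_cycle)
  then have "singular_relcycle p ?A {} (chain_map p (\<lambda>P. a) z)"
    by (rule singular_relcycle_chain_map) auto
  then have "singular_relboundary p ?A {} (chain_map p (\<lambda>P. a) z)"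
    by (simp add: singular_boundary_eq_cycle_singleton[OF tA p])
  then obtain d where d: "singular_chain (Suc p) ?A d" "chain_boundary (Suc p) d = chain_map p (\<lambda>P. a) z"
    by (auto simp: singular_boundary)
  \<comment> \<open>The bounding chain \<open>d\<close> consists of constant simplices, which are continuous.\<close>
  have "cont_into ?A (suspension_space X) (suspension_closure X c) (\<lambda>_. a)"
    unfolding a_def by (rule cont_into_suspension_proj[OF X cont_into_const[OF X x]]) (use eI in auto)
  then have "cont_into ?A (suspension_space X) (suspension_closure X c) id"
    by (subst cont_into_cong[where g = "\<lambda>_. a"]) auto
  then have "suspension_chain (Suc p) X c (punctured X e) (chain_map (Suc p) id d)"
    by (rule closure_chain_push[OF d(1)]) (use a in auto)
  then have "suspension_chain (Suc p) X c (punctured X e) d"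
    by (simp only: chain_map_ident[OF d(1)])
  then have "suspension_chain (Suc p) X c (punctured X e) (d - w)"
    by (rule closure_chain_diff[OF _ w(1)])
  moreover have "chain_boundary (Suc p) (d - w) = z"
    using w(2) d(2) by (simp add: chain_boundary_diff 0 1)
  ultimately show thesis
    by (rule that)
qed

definition equator :: "'a set \<Rightarrow> 'a \<Rightarrow> ('a \<times> real) set" where
  "equator X x = suspension_proj X (x, 1 / 2)"

lemma base_point_equator: "x \<in> X \<Longrightarrow> base_point X (equator X x) = x"
  by (simp add: equator_def base_point_proj)

lemma suspension_proj_in_waist:
  "x \<in> X \<Longrightarrow> 0 < t \<Longrightarrow> t < 1 \<Longrightarrow> suspension_proj X (x, t) \<in> waist X"
  by (simp add: waist_eq height_proj)

lemma suspension_chain_equator: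
  assumes X: "closure_space X c" and z: "closure_chain p X c X z"
  shows "suspension_chain p X c (waist X) (chain_map p (equator X) z)"
proof (rule closure_chain_chain_map[OF z])
  fix f
  assume f: "closure_singular_simplex p X c f" "f ` standard_simplex p \<subseteq> X"
  have "cont_into (simplex_topology p) X c f"
    using f(1) by (simp only: closure_singular_simplex_iff)
  then have "cont_into (simplex_topology p) (suspension_space X) (suspension_closure X c)
      (\<lambda>x. suspension_proj X (f x, 1 / 2))"
    by (rule cont_into_suspension_proj[OF X]) simp
  moreover have "(\<lambda>x. equator X (f x)) ` standard_simplex p \<subseteq> waist X"
    using f(2) suspension_proj_in_waist[of _ X "1 / 2"] unfolding equator_def
    by (intro image_subsetI) fastforce
  ultimately show "cont_into (simplex_topology p) (suspension_space X) (suspension_closure X c) (\<lambda>x. equator X (f x)) \<and>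
       (\<lambda>x. equator X (f x)) ` standard_simplex p \<subseteq> waist X"
    by (simp only: equator_def)
qed

lemma closure_chain_base_point:
  assumes X: "closure_space X c" and z: "suspension_chain p X c (waist X) z"
  shows "closure_chain p X c X (chain_map p (base_point X) z)"
proof (rule closure_chain_chain_map[OF z])
  fix f
  assume f: "closure_singular_simplex p (suspension_space X) (suspension_closure X c) f"
    "f ` standard_simplex p \<subseteq> waist X"
  then show "cont_into (simplex_topology p) X c (\<lambda>x. base_point X (f x)) \<and>
       (\<lambda>x. base_point X (f x)) ` standard_simplex p \<subseteq> X"
    using cont_into_base_point[OF X, of "simplex_topology p" f]
    by (auto simp: closure_singular_simplex_iff punctured_def intro: suspension_rep(1))
qed

text \<open>
  The homotopy keeps base points and moves heights linearly to \<open>1 / 2\<close>, so it stays within the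
  heights strictly between 0 and 1.
\<close>

lemma waist_cycle_homologous_equator:
  assumes X: "closure_space X c"
    and z: "suspension_chain p X c (waist X) z" "chain_boundary p z = 0"
  obtains w where "suspension_chain (Suc p) X c (waist X) w"
    "chain_boundary (Suc p) w = chain_map p (equator X) (chain_map p (base_point X) z) - z"
proof -
  define \<Gamma> where "\<Gamma> P t = suspension_proj X (base_point X P, (1 - t) * height X P + t * (1 / 2))" for P t
  have hom: "cont_into (cylinder p) (suspension_space X) (suspension_closure X c) (\<lambda>(y, t). \<Gamma> (f y) t) \<and>
          (\<lambda>(y, t). \<Gamma> (f y) t) ` topspace (cylinder p) \<subseteq> waist X"
    if f: "closure_singular_simplex p (suspension_space X) (suspension_closure X c) f"
      "f ` standard_simplex p \<subseteq> waist X" for f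
  proof -
    have fc: "cont_into (cylinder p) (suspension_space X) (suspension_closure X c) (f \<circ> fst)"
      by (rule cont_into_compose[OF continuous_map_fst]) (use f in \<open>simp add: closure_singular_simplex_iff\<close>)
    have fw: "(f \<circ> fst) ` topspace (cylinder p) \<subseteq> waist X"
      using f(2) by auto
    note b = cont_into_base_point[OF X fc fw]
    let ?r = "\<lambda>u. (1 - snd u) * height X ((f \<circ> fst) u) + snd u * (1 / 2)"
    have r01: "0 < ?r u \<and> ?r u < 1" if u: "u \<in> topspace (cylinder p)" for u
    proof -
      have h: "0 < height X ((f \<circ> fst) u)" "height X ((f \<circ> fst) u) < 1"
        using fw u unfolding waist_eq by blast+
      have t: "0 \<le> snd u" "snd u \<le> 1"
        using u by auto
      show ?thesis
        using convex_bound_lt[of "height X ((f \<circ> fst) u)" 1 "1/2" "1 - snd u" "snd u"] 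
          convex_bound_lt[of "- height X ((f \<circ> fst) u)" 0 "-1/2" "1 - snd u" "snd u"] h t
        by auto
    qed
    have r: "continuous_map (cylinder p) (top_of_set unit_interval) ?r"
      unfolding continuous_map_in_subtopology
    proof
      show "continuous_map (cylinder p) euclideanreal ?r"
        using continuous_map_height[OF X fc]
          continuous_map_into_fulltopology[OF continuous_map_snd[of "simplex_topology p" "top_of_set unit_interval"]]
        by (intro continuous_map_add continuous_map_real_mult continuous_map_diff) auto
      show "?r \<in> topspace (cylinder p) \<rightarrow> unit_interval"
        using r01 by (fastforce intro: less_imp_le)
    qed
    have eq: "(\<lambda>(y, t). \<Gamma> (f y) t) = (\<lambda>u. suspension_proj X (base_point X ((f \<circ> fst) u), ?r u))"
      by (auto simp: \<Gamma>_def)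
    have "base_point X ((f \<circ> fst) u) \<in> X" if "u \<in> topspace (cylinder p)" for u
      using fw that suspension_rep(1) unfolding punctured_def by blast
    then show ?thesis
      unfolding eq using cont_into_suspension_proj[OF X b r] r01 suspension_proj_in_waist[of _ X] by blast
  qed
  obtain w where w: "suspension_chain (Suc p) X c (waist X) w"
    "chain_boundary (Suc p) w
       = chain_map p (\<lambda>P. \<Gamma> P 1) ((singular_subdivision p ^^ 0) z) - chain_map p (\<lambda>P. \<Gamma> P 0) z"
    by (rule homologous_by_homotopy[OF hom z])
  have "chain_map p (\<lambda>P. \<Gamma> P 0) z = z"
    by (rule chain_map_closure_chain_id[OF z(1)]) (simp add: \<Gamma>_def punctured_def suspension_rep(4))
  moreover have "(\<lambda>P. \<Gamma> P 1) = (\<lambda>P. equator X (base_point X P))"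
    by (simp add: \<Gamma>_def equator_def)
  ultimately show thesis
    using that w by (simp add: chain_map_chain_map)
qed

text \<open>
  Simplices are continuous for the topology on the suspension that is pulled back along the height,
  and the two cones are open in it.  The existence of fine enough subdivisions for an open cover of
  a topological space therefore applies.
\<close>

lemma suspension_chain_subdivision_splits:
  assumes X: "closure_space X c" and z: "suspension_chain p X c (suspension_space X) z"
  obtains n a b where "(singular_subdivision p ^^ n) z = a + b"
    "suspension_chain p X c (punctured X 0) a" "suspension_chain p X c (punctured X 1) b"
proof -
  let ?T = "pullback_topology (suspension_space X) (height X) euclideanreal"
  have tT: "topspace ?T = suspension_space X"
    by (simp add: topspace_pullback_topology)
  have "singular_simplex p ?T f"
    if f: "closure_singular_simplex p (suspension_space X) (suspension_closure X c) f" for f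
  proof -
    have f': "cont_into (simplex_topology p) (suspension_space X) (suspension_closure X c) f"
      "f \<in> extensional (standard_simplex p)"
      using f by (auto simp: closure_singular_simplex_iff)
    have "continuous_map (simplex_topology p) ?T f"
      by (rule continuous_map_pullback')
         (use continuous_map_height[OF X f'(1)] f'(1) in \<open>auto simp: o_def closure_continuous_def\<close>)
    then show ?thesis
      using f'(2) by (simp add: singular_simplex_def)
  qed
  then have zT: "singular_chain p ?T z"
    using z by (auto simp: singular_chain_def closure_chain_def)
  have "openin ?T (punctured X e)" for e
    unfolding openin_pullback_topology
    by (rule exI[of _ "- {1 - e}"]) (auto simp: punctured_def)
  then have op: "\<And>U. U \<in> {punctured X 0, punctured X 1} \<Longrightarrow> openin ?T U"
    by blast
  have cover: "topspace ?T \<subseteq> \<Union> {punctured X 0, punctured X 1}"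
    unfolding tT by (auto simp: punctured_def)
  obtain n where n: "\<And>m f. \<lbrakk>n \<le> m; f \<in> Poly_Mapping.keys ((singular_subdivision p ^^ m) z)\<rbrakk>
            \<Longrightarrow> \<exists>V \<in> {punctured X 0, punctured X 1}. f \<in> (standard_simplex p) \<rightarrow> V"
    using sufficient_iterated_singular_subdivision_exists[OF op cover zT] by metis
  let ?K = "\<lambda>S. {f. closure_singular_simplex p (suspension_space X) (suspension_closure X c) f
                     \<and> f ` standard_simplex p \<subseteq> S}"
  have "Poly_Mapping.keys ((singular_subdivision p ^^ n) z) \<subseteq> ?K (punctured X 0) \<union> ?K (punctured X 1)"
  proof
    fix f
    assume f: "f \<in> Poly_Mapping.keys ((singular_subdivision p ^^ n) z)"
    then have "closure_singular_simplex p (suspension_space X) (suspension_closure X c) f"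
      using closure_chain_iterated_subdivision[OF z, of n] by (auto simp: closure_chain_def)
    then show "f \<in> ?K (punctured X 0) \<union> ?K (punctured X 1)"
      using n[OF order_refl f] by auto
  qed
  then obtain a b where "Poly_Mapping.keys a \<subseteq> ?K (punctured X 0)"
      "Poly_Mapping.keys b \<subseteq> ?K (punctured X 1)" "a + b = (singular_subdivision p ^^ n) z"
    by (rule frag_split)
  then show thesis
    using that[of n a b] by (simp add: closure_chain_def)
qed

section \<open>The Mayer-Vietoris argument\<close>

text \<open>
  The inverse of the Mayer-Vietoris connecting homomorphism as a relation between cycles: \<open>y\<close> is
  glued from two chains, one in each cone, that both fill in the copy of \<open>x\<close> on the equator.
\<close>

definition suspends ::
    "nat \<Rightarrow> 'a set \<Rightarrow> ('a set \<Rightarrow> 'a set) \<Rightarrow> 'a chain \<Rightarrow> ('a \<times> real) set chain \<Rightarrow> bool" where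
  "suspends k X c x y \<longleftrightarrow>
     (\<exists>a b. suspension_chain (Suc k) X c (punctured X 0) a \<and>
            suspension_chain (Suc k) X c (punctured X 1) b \<and>
            chain_boundary (Suc k) a = chain_map k (equator X) x \<and>
            chain_boundary (Suc k) b = chain_map k (equator X) x \<and> y = a - b)"

lemma punctured_subset: "punctured X e \<subseteq> suspension_space X"
  by (auto simp: punctured_def)

lemma suspends_chain:
  assumes "suspends k X c x y"
  shows "suspension_chain (Suc k) X c (suspension_space X) y" "chain_boundary (Suc k) y = 0"
proof -
  obtain a b where a: "suspension_chain (Suc k) X c (punctured X 0) a"
    and b: "suspension_chain (Suc k) X c (punctured X 1) b"
    and "chain_boundary (Suc k) a = chain_boundary (Suc k) b" and y: "y = a - b"
    using assms unfolding suspends_def by auto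
  then show "chain_boundary (Suc k) y = 0"
    by (simp add: chain_boundary_diff)
  show "suspension_chain (Suc k) X c (suspension_space X) y"
    unfolding y
    by (rule closure_chain_diff[OF closure_chain_mono[OF a punctured_subset]
          closure_chain_mono[OF b punctured_subset]])
qed

lemma suspends_diff:
  assumes "suspends k X c x y" "suspends k X c x' y'"
  shows "suspends k X c (x - x') (y - y')"
proof -
  obtain a b where "suspension_chain (Suc k) X c (punctured X 0) a"
            "suspension_chain (Suc k) X c (punctured X 1) b"
            "chain_boundary (Suc k) a = chain_map k (equator X) x"
            "chain_boundary (Suc k) b = chain_map k (equator X) x" "y = a - b"
    using assms(1) unfolding suspends_def by blast
  moreover obtain a' b' where "suspension_chain (Suc k) X c (punctured X 0) a'"
            "suspension_chain (Suc k) X c (punctured X 1) b'"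
            "chain_boundary (Suc k) a' = chain_map k (equator X) x'"
            "chain_boundary (Suc k) b' = chain_map k (equator X) x'" "y' = a' - b'"
    using assms(2) unfolding suspends_def by blast
  ultimately show ?thesis
    unfolding suspends_def
    by (intro exI[of _ "a - a'"] exI[of _ "b - b'"])
       (auto simp: closure_chain_diff chain_boundary_diff chain_map_diff)
qed

lemma suspends_exists:
  assumes X: "closure_space X c" and k: "1 \<le> k"
    and x: "closure_chain k X c X x" "chain_boundary k x = 0"
  obtains y where "suspends k X c x y"
proof -
  let ?j = "chain_map k (equator X) x"
  have j: "suspension_chain k X c (punctured X e) ?j" if "e \<in> {0, 1}" for e
    using suspension_chain_equator[OF X x(1)] that by (auto simp: closure_chain_Int)
  have dj: "chain_boundary k ?j = 0"
    using chain_boundary_chain_map[OF closure_chain_imp_singular_chain[OF x(1)], of "equator X"] x(2)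
    by simp
  obtain a where "suspension_chain (Suc k) X c (punctured X 0) a" "chain_boundary (Suc k) a = ?j"
    by (rule punctured_cycle_imp_boundary[OF X _ k j dj, of 0]) auto
  moreover obtain b where "suspension_chain (Suc k) X c (punctured X 1) b" "chain_boundary (Suc k) b = ?j"
    by (rule punctured_cycle_imp_boundary[OF X _ k j dj, of 1]) auto
  ultimately show thesis
    using that unfolding suspends_def by blast
qed

text \<open>
  A subdivision of \<open>z\<close> splits as \<open>a + b\<close> along the two cones, so \<open>\<partial> a = - \<partial> b\<close> is a cycle with
  heights strictly between 0 and 1.  A homotopy \<open>h\<close> moves this cycle to
  the equator, where it is filled in by \<open>a + h\<close> in one cone and by \<open>h - b\<close> in the other.
\<close>

lemma suspends_surj:
  assumes X: "closure_space X c"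
    and z: "suspension_chain (Suc k) X c (suspension_space X) z" "chain_boundary (Suc k) z = 0"
  obtains x y w where "closure_chain k X c X x" "chain_boundary k x = 0" "suspends k X c x y"
    "suspension_chain (Suc (Suc k)) X c (suspension_space X) w"
    "chain_boundary (Suc (Suc k)) w = y - z"
proof -
  obtain n a b where sd: "(singular_subdivision (Suc k) ^^ n) z = a + b"
    and a: "suspension_chain (Suc k) X c (punctured X 0) a"
    and b: "suspension_chain (Suc k) X c (punctured X 1) b"
    by (rule suspension_chain_subdivision_splits[OF X z(1)])
  obtain w where w: "suspension_chain (Suc (Suc k)) X c (suspension_space X) w"
    "chain_boundary (Suc (Suc k)) w = (singular_subdivision (Suc k) ^^ n) z - z"
    by (rule subdivided_cycle_homologous[OF z])
  define v where "v = chain_boundary (Suc k) a"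
  have "chain_boundary (Suc k) (a + b) = 0"
    using chain_boundary_iterated_subdivision[OF closure_chain_imp_singular_chain[OF z(1)], of n]
    by (simp add: z(2) flip: sd)
  then have db: "chain_boundary (Suc k) b = - v"
    by (simp add: v_def chain_boundary_add eq_neg_iff_add_eq_0 add.commute)
  have "suspension_chain k X c (punctured X 0) v"
    unfolding v_def by (rule closure_chain_boundary_Suc[OF a])
  moreover have "suspension_chain k X c (punctured X 1) v"
    using closure_chain_minus[OF closure_chain_boundary_Suc[OF b]] db by simp
  ultimately have v: "suspension_chain k X c (waist X) v"
    by (simp add: closure_chain_Int)
  have dv: "chain_boundary k v = 0"
    unfolding v_def by (rule closure_chain_boundary_boundary[OF a])
  obtain h where h: "suspension_chain (Suc k) X c (waist X) h"
    "chain_boundary (Suc k) h = chain_map k (equator X) (chain_map k (base_point X) v) - v"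
    by (rule waist_cycle_homologous_equator[OF X v dv])
  show thesis
  proof
    show "closure_chain k X c X (chain_map k (base_point X) v)"
      by (rule closure_chain_base_point[OF X v])
    show "chain_boundary k (chain_map k (base_point X) v) = 0"
      using chain_boundary_chain_map[OF closure_chain_imp_singular_chain[OF v], of "base_point X"] dv
      by simp
    show "suspends k X c (chain_map k (base_point X) v) ((a + h) - (h - b))"
      unfolding suspends_def
      using a b h closure_chain_Int[of "Suc k" "suspension_space X" "suspension_closure X c" "punctured X 0" "punctured X 1" h]
      by (intro exI[of _ "a + h"] exI[of _ "h - b"])
         (simp add: closure_chain_add closure_chain_diff chain_boundary_add chain_boundary_diff db
            flip: v_def)
    show "suspension_chain (Suc (Suc k)) X c (suspension_space X) w"
      by (rule w(1))
    show "chain_boundary (Suc (Suc k)) w = (a + h) - (h - b) - z"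
      using w(2) by (simp add: sd)
  qed
qed

text \<open>
  If \<open>a - b = \<partial> d\<close>, a subdivision of \<open>d\<close> splits along the cones, and comparing its boundary with
  the subdivision of \<open>a - b\<close> gives a chain in the intersection of the cones that fills in the
  subdivided copy of \<open>x\<close> on the equator; its projection to \<open>X\<close> fills in a subdivision of \<open>x\<close>.
  Conversely, if \<open>x\<close> bounds \<open>u\<close>, the copy of \<open>u\<close> on the equator completes both \<open>a\<close> and \<open>b\<close> to cycles
  in the cones, which bound.  Together with \<open>suspends_diff\<close>, the case \<open>x = 0\<close> shows that all
  cycles obtained from the same \<open>x\<close> are homologous.
\<close>

lemma suspends_boundary_iff:
  assumes X: "closure_space X c"
    and x: "closure_chain k X c X x" "chain_boundary k x = 0" and s: "suspends k X c x y"
  shows "(\<exists>d. suspension_chain (Suc (Suc k)) X c (suspension_space X) d \<and> chain_boundary (Suc (Suc k)) d = y)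
     \<longleftrightarrow> (\<exists>u. closure_chain (Suc k) X c X u \<and> chain_boundary (Suc k) u = x)" (is "?l \<longleftrightarrow> ?r")
proof -
  obtain a b where a: "suspension_chain (Suc k) X c (punctured X 0) a"
    and b: "suspension_chain (Suc k) X c (punctured X 1) b"
    and da: "chain_boundary (Suc k) a = chain_map k (equator X) x"
    and db: "chain_boundary (Suc k) b = chain_map k (equator X) x" and y: "y = a - b"
    using s unfolding suspends_def by blast
  show ?thesis
  proof
    assume ?l
    then obtain d where d: "suspension_chain (Suc (Suc k)) X c (suspension_space X) d"
      "chain_boundary (Suc (Suc k)) d = a - b"
      using y by blast
    obtain n d0 d1 where sd: "(singular_subdivision (Suc (Suc k)) ^^ n) d = d0 + d1"
      and d0: "suspension_chain (Suc (Suc k)) X c (punctured X 0) d0"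
      and d1: "suspension_chain (Suc (Suc k)) X c (punctured X 1) d1"
      by (rule suspension_chain_subdivision_splits[OF X d(1)])
    let ?sa = "(singular_subdivision (Suc k) ^^ n) a" and ?sb = "(singular_subdivision (Suc k) ^^ n) b"
    have "chain_boundary (Suc (Suc k)) (d0 + d1) = ?sa - ?sb"
      using chain_boundary_iterated_subdivision[OF closure_chain_imp_singular_chain[OF d(1)], of n]
      by (simp add: d(2) singular_subdivision_power_diff flip: sd)
    \<comment> \<open>The common value of a chain in one cone and a chain in the other lies in both.\<close>
    define e where "e = ?sa - chain_boundary (Suc (Suc k)) d0"
    have e': "e = ?sb + chain_boundary (Suc (Suc k)) d1"
      using \<open>chain_boundary (Suc (Suc k)) (d0 + d1) = ?sa - ?sb\<close>
      by (simp add: e_def chain_boundary_add algebra_simps)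
    have "suspension_chain (Suc k) X c (punctured X 0) e"
      unfolding e_def
      by (intro closure_chain_diff closure_chain_iterated_subdivision a closure_chain_boundary_Suc d0)
    moreover have "suspension_chain (Suc k) X c (punctured X 1) e"
      unfolding e'
      by (intro closure_chain_add closure_chain_iterated_subdivision b closure_chain_boundary_Suc d1)
    ultimately have e: "suspension_chain (Suc k) X c (waist X) e"
      by (simp add: closure_chain_Int)
    note sx = closure_chain_imp_singular_chain[OF x(1)]
    have de: "chain_boundary (Suc k) e = (singular_subdivision k ^^ n) (chain_map k (equator X) x)"
      using chain_boundary_iterated_subdivision[OF closure_chain_imp_singular_chain[OF a], of n]
      by (simp add: e_def chain_boundary_diff closure_chain_boundary_boundary[OF d0] da)
    have "chain_boundary (Suc k) (chain_map (Suc k) (base_point X) e)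
            = chain_map k (base_point X) (chain_boundary (Suc k) e)"
      using chain_boundary_chain_map[OF closure_chain_imp_singular_chain[OF e], of "base_point X"] by simp
    also have "\<dots> = chain_map k (\<lambda>x. base_point X (equator X x)) ((singular_subdivision k ^^ n) x)"
      by (simp add: de naturality_iterated_subdivision[OF sx] chain_map_chain_map)
    also have "\<dots> = (singular_subdivision k ^^ n) x"
      by (rule chain_map_closure_chain_id[OF closure_chain_iterated_subdivision[OF x(1)]])
         (simp add: base_point_equator)
    finally have bd: "chain_boundary (Suc k) (chain_map (Suc k) (base_point X) e) = (singular_subdivision k ^^ n) x" .
    obtain w where w: "closure_chain (Suc k) X c X w"
      "chain_boundary (Suc k) w = (singular_subdivision k ^^ n) x - x"
      by (rule subdivided_cycle_homologous[OF x])
    show ?r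
      by (rule exI[of _ "chain_map (Suc k) (base_point X) e - w"])
         (simp add: closure_chain_diff closure_chain_base_point[OF X e] w chain_boundary_diff bd)
  next
    assume ?r
    then obtain u where u: "closure_chain (Suc k) X c X u" "chain_boundary (Suc k) u = x"
      by blast
    let ?j = "chain_map (Suc k) (equator X) u"
    have j: "suspension_chain (Suc k) X c (punctured X 0) ?j" "suspension_chain (Suc k) X c (punctured X 1) ?j"
      using suspension_chain_equator[OF X u(1)] by (auto simp: closure_chain_Int)
    have dj: "chain_boundary (Suc k) ?j = chain_map k (equator X) x"
      using chain_boundary_chain_map[OF closure_chain_imp_singular_chain[OF u(1)], of "equator X"] u(2)
      by simp
    obtain d0 where d0: "suspension_chain (Suc (Suc k)) X c (punctured X 0) d0"
        "chain_boundary (Suc (Suc k)) d0 = a - ?j"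
      by (rule punctured_cycle_imp_boundary[OF X _ _ closure_chain_diff[OF a j(1)]])
         (simp_all add: chain_boundary_diff da dj)
    obtain d1 where d1: "suspension_chain (Suc (Suc k)) X c (punctured X 1) d1"
        "chain_boundary (Suc (Suc k)) d1 = b - ?j"
      by (rule punctured_cycle_imp_boundary[OF X _ _ closure_chain_diff[OF b j(2)]])
         (simp_all add: chain_boundary_diff db dj)
    show ?l
      by (rule exI[of _ "d0 - d1"])
         (simp add: closure_chain_diff closure_chain_mono[OF d0(1) punctured_subset]
           closure_chain_mono[OF d1(1) punctured_subset] chain_boundary_diff d0(2) d1(2) y)
  qed
qed

section \<open>Homology groups\<close>

text \<open>
  The map \<open>\<phi>\<close> need only be a homomorphism up to elements of \<open>M\<close>, which permits arbitrary choices of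
  representatives in its definition.
\<close>

lemma FactGroup_iso_of_hom_mod:
  assumes G: "comm_group G" "subgroup N G" and H: "comm_group H" "subgroup M H"
    and closed: "\<And>x. x \<in> carrier G \<Longrightarrow> \<phi> x \<in> carrier H"
    and mult: "\<And>x y. x \<in> carrier G \<Longrightarrow> y \<in> carrier G \<Longrightarrow>
                 \<phi> (x \<otimes>\<^bsub>G\<^esub> y) \<in> M #>\<^bsub>H\<^esub> (\<phi> x \<otimes>\<^bsub>H\<^esub> \<phi> y)"
    and ker: "\<And>x. x \<in> carrier G \<Longrightarrow> \<phi> x \<in> M \<longleftrightarrow> x \<in> N"
    and surj: "\<And>y. y \<in> carrier H \<Longrightarrow> \<exists>x\<in>carrier G. \<phi> x \<in> M #>\<^bsub>H\<^esub> y"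
  shows "G Mod N \<cong> H Mod M"
proof -
  interpret G: comm_group G by (rule G)
  interpret H: comm_group H by (rule H)
  have M: "M \<lhd> H"
    by (simp add: H.normal_iff_subgroup H(2))
  let ?h = "\<lambda>x. M #>\<^bsub>H\<^esub> \<phi> x"
  interpret Q: group "H Mod M"
    by (rule normal.factorgroup_is_group[OF M])
  have "?h \<in> hom G (H Mod M)"
  proof (rule homI)
    fix x y
    assume xy: "x \<in> carrier G" "y \<in> carrier G"
    have "?h (x \<otimes>\<^bsub>G\<^esub> y) = M #>\<^bsub>H\<^esub> (\<phi> x \<otimes>\<^bsub>H\<^esub> \<phi> y)"
      using H.repr_independence[OF mult[OF xy] _ H(2)] closed xy by simp
    also have "\<dots> = ?h x <#>\<^bsub>H\<^esub> ?h y"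
      using normal.rcos_sum[OF M] closed xy by simp
    finally show "?h (x \<otimes>\<^bsub>G\<^esub> y) = ?h x \<otimes>\<^bsub>H Mod M\<^esub> ?h y"
      by simp
  qed (use closed in \<open>auto simp: carrier_FactGroup\<close>)
  then interpret h: group_hom G "H Mod M" ?h
    by unfold_locales
  have "kernel G (H Mod M) ?h = {x \<in> carrier G. \<phi> x \<in> M}"
    unfolding kernel_def using H.coset_join1[OF _ _ H(2)] H.coset_join2[OF _ H(2)] closed by auto
  also have "\<dots> = N"
    using ker subgroup.subset[OF G(2)] by blast
  finally have "kernel G (H Mod M) ?h = N" .
  moreover have "?h ` carrier G = carrier (H Mod M)"
  proof
    show "carrier (H Mod M) \<subseteq> ?h ` carrier G"
    proof
      fix C
      assume "C \<in> carrier (H Mod M)"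
      then obtain y where y: "y \<in> carrier H" "C = M #>\<^bsub>H\<^esub> y"
        by (auto simp: carrier_FactGroup)
      then obtain x where "x \<in> carrier G" "\<phi> x \<in> M #>\<^bsub>H\<^esub> y"
        using surj by blast
      then show "C \<in> ?h ` carrier G"
        using H.repr_independence[OF _ y(1) H(2)] y(2) by blast
    qed
  qed (use closed in \<open>auto simp: carrier_FactGroup\<close>)
  ultimately show ?thesis
    using h.FactGroup_iso by simp
qed

abbreviation closure_cycle_group ::
    "nat \<Rightarrow> 'a set \<Rightarrow> ('a set \<Rightarrow> 'a set) \<Rightarrow> 'a chain monoid" where
  "closure_cycle_group n X c \<equiv>
     subgroup_generated (closure_chain_group n X c) (closure_cycles n X c)"

lemma group_closure_chain_group: "group (closure_chain_group n X c)"
  by (simp add: closure_chain_group_def)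

lemma comm_group_closure_cycle_group: "comm_group (closure_cycle_group n X c)"
  by (rule group.abelian_subgroup_generated[OF group_closure_chain_group])
     (simp add: closure_chain_group_def abelian_free_Abelian_group)

lemma mult_closure_chain_group [simp]: "x \<otimes>\<^bsub>closure_chain_group n X c\<^esub> y = x + y"
  by (simp add: closure_chain_group_def)

lemma subgroup_closure_chain_groupI:
  assumes "\<And>x. x \<in> A \<Longrightarrow> closure_chain n X c X x" "0 \<in> A"
    and diff: "\<And>x y. x \<in> A \<Longrightarrow> y \<in> A \<Longrightarrow> x - y \<in> A"
  shows "subgroup A (closure_chain_group n X c)"
proof (rule group.subgroupI[OF group_closure_chain_group])
  show "A \<subseteq> carrier (closure_chain_group n X c)"
    using assms(1) by (auto simp: carrier_closure_chain_group)
  fix x y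
  assume x: "x \<in> A" and y: "y \<in> A"
  have "x \<in> carrier (closure_chain_group n X c)"
    using assms(1)[OF x] by (simp only: carrier_closure_chain_group)
  then have "inv\<^bsub>closure_chain_group n X c\<^esub> x = 0 - x"
    by (simp add: closure_chain_group_def)
  then show "inv\<^bsub>closure_chain_group n X c\<^esub> x \<in> A"
    using diff[OF assms(2) x] by simp
  have "x - (0 - y) \<in> A"
    by (intro diff x y assms(2))
  then show "x \<otimes>\<^bsub>closure_chain_group n X c\<^esub> y \<in> A"
    by simp
qed (use assms(2) in auto)

lemma mem_closure_cycles:
  "z \<in> closure_cycles n X c \<longleftrightarrow> closure_chain n X c X z \<and> chain_boundary n z = 0"
  by (simp only: closure_cycles_def mem_Collect_eq carrier_closure_chain_group)

lemma mem_closure_boundaries: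
  "z \<in> closure_boundaries n X c \<longleftrightarrow>
     (\<exists>d. closure_chain (Suc n) X c X d \<and> chain_boundary (Suc n) d = z)"
proof -
  have "closure_boundaries n X c = chain_boundary (Suc n) ` {d. closure_chain (Suc n) X c X d}"
    unfolding closure_boundaries_def
    by (rule arg_cong[where f = "image _"]) (simp only: set_eq_iff carrier_closure_chain_group mem_Collect_eq, simp)
  then show ?thesis
    by auto
qed

lemma carrier_closure_cycle_group:
  "carrier (closure_cycle_group n X c) = closure_cycles n X c"
proof (rule subgroup.carrier_subgroup_generated_subgroup[OF subgroup_closure_chain_groupI])
qed (auto simp: mem_closure_cycles chain_boundary_diff closure_chain_diff)

lemma subgroup_closure_boundaries:
  "subgroup (closure_boundaries n X c) (closure_cycle_group n X c)"
proof (rule group.subgroup_of_subgroup_generated[OF group_closure_chain_group])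
  show "closure_boundaries n X c \<subseteq> closure_cycles n X c"
    using closure_chain_boundary_Suc closure_chain_boundary_boundary
    by (fastforce simp: mem_closure_boundaries mem_closure_cycles)
  show "subgroup (closure_boundaries n X c) (closure_chain_group n X c)"
  proof (rule subgroup_closure_chain_groupI)
    fix x y
    assume "x \<in> closure_boundaries n X c" "y \<in> closure_boundaries n X c"
    then show "x - y \<in> closure_boundaries n X c"
      unfolding mem_closure_boundaries by (metis closure_chain_diff chain_boundary_diff)
  next
    show "0 \<in> closure_boundaries n X c"
      unfolding mem_closure_boundaries by (intro exI[of _ 0]) simp
  qed (auto simp: mem_closure_boundaries closure_chain_boundary_Suc)
qed

lemma mem_boundary_coset:
  "y \<in> closure_boundaries n X c #>\<^bsub>closure_cycle_group n X c\<^esub> z \<longleftrightarrow> y - z \<in> closure_boundaries n X c"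
  by (auto simp: r_coset_def) (metis diff_add_cancel)

theorem proposition4p10:
  fixes X :: "'a set" and c :: "'a set \<Rightarrow> 'a set" and k :: nat
  assumes "closure_space X c" and "k \<ge> 1"
  shows "closure_homology_group (k + 1) (suspension_space X) (suspension_closure X c)
           \<cong> closure_homology_group k X c"
proof -
  note X = assms(1) and k = assms(2)
  let ?G = "closure_cycle_group k X c" and ?N = "closure_boundaries k X c"
  let ?H = "closure_cycle_group (Suc k) (suspension_space X) (suspension_closure X c)"
  let ?M = "closure_boundaries (Suc k) (suspension_space X) (suspension_closure X c)"
  define \<phi> where "\<phi> x = (SOME y. suspends k X c x y)" for x
  have \<phi>: "suspends k X c x (\<phi> x)" if "x \<in> carrier ?G" for x
  proof -
    have "\<exists>y. suspends k X c x y"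
      using suspends_exists[OF X k] that
      by (metis carrier_closure_cycle_group mem_closure_cycles)
    then show ?thesis
      unfolding \<phi>_def by (rule someI_ex)
  qed
  have iff: "y \<in> ?M \<longleftrightarrow> x \<in> ?N" if "x \<in> carrier ?G" "suspends k X c x y" for x y
    using suspends_boundary_iff[OF X _ _ that(2)] that(1)
    by (simp only: carrier_closure_cycle_group mem_closure_cycles mem_closure_boundaries)
  have "0 \<in> ?N"
    unfolding mem_closure_boundaries by (intro exI[of _ 0]) simp
  have "?G Mod ?N \<cong> ?H Mod ?M"
  proof (rule FactGroup_iso_of_hom_mod[where \<phi> = \<phi>])
    fix x
    assume x: "x \<in> carrier ?G"
    show "\<phi> x \<in> carrier ?H"
      using suspends_chain[OF \<phi>[OF x]] by (simp only: carrier_closure_cycle_group mem_closure_cycles)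
    show "\<phi> x \<in> ?M \<longleftrightarrow> x \<in> ?N"
      by (rule iff[OF x \<phi>[OF x]])
    fix y
    assume y: "y \<in> carrier ?G"
    \<comment> \<open>The defect in additivity of \<open>\<phi>\<close> corresponds to the cycle \<open>0\<close> and therefore bounds.\<close>
    have xy: "x + y \<in> carrier ?G"
      using x y by (simp add: carrier_closure_cycle_group mem_closure_cycles closure_chain_add chain_boundary_add)
    then have "suspends k X c (x + y - x - y) (\<phi> (x + y) - \<phi> x - \<phi> y)"
      by (intro suspends_diff \<phi> x y)
    then have "\<phi> (x + y) - \<phi> x - \<phi> y \<in> ?M"
      using iff[of 0] \<open>0 \<in> ?N\<close> by (simp add: carrier_closure_cycle_group mem_closure_cycles)
    then show "\<phi> (x \<otimes>\<^bsub>?G\<^esub> y) \<in> ?M #>\<^bsub>?H\<^esub> (\<phi> x \<otimes>\<^bsub>?H\<^esub> \<phi> y)"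
      by (simp add: mem_boundary_coset diff_diff_add)
  next
    fix z
    assume "z \<in> carrier ?H"
    then have z: "suspension_chain (Suc k) X c (suspension_space X) z" "chain_boundary (Suc k) z = 0"
      by (simp_all only: carrier_closure_cycle_group mem_closure_cycles)
    obtain x y w where x: "closure_chain k X c X x" "chain_boundary k x = 0" and y: "suspends k X c x y"
      and w: "suspension_chain (Suc (Suc k)) X c (suspension_space X) w"
        "chain_boundary (Suc (Suc k)) w = y - z"
      by (rule suspends_surj[OF X z])
    have xG: "x \<in> carrier ?G"
      using x by (simp only: carrier_closure_cycle_group mem_closure_cycles)
    have "suspends k X c (x - x) (\<phi> x - y)"
      by (intro suspends_diff \<phi> xG y)
    then have "\<phi> x - y \<in> ?M"
      using iff[of 0] \<open>0 \<in> ?N\<close> by (simp add: carrier_closure_cycle_group mem_closure_cycles)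
    then obtain v where v: "suspension_chain (Suc (Suc k)) X c (suspension_space X) v"
        "chain_boundary (Suc (Suc k)) v = \<phi> x - y"
      by (auto simp only: mem_closure_boundaries)
    have "\<phi> x - z \<in> ?M"
      unfolding mem_closure_boundaries
      by (rule exI[of _ "v + w"]) (simp add: closure_chain_add v w chain_boundary_add)
    then show "\<exists>x\<in>carrier ?G. \<phi> x \<in> ?M #>\<^bsub>?H\<^esub> z"
      using xG by (auto simp: mem_boundary_coset)
  qed (rule comm_group_closure_cycle_group subgroup_closure_boundaries)+
  then have "closure_homology_group k X c
      \<cong> closure_homology_group (k + 1) (suspension_space X) (suspension_closure X c)"
    by (simp add: closure_homology_group_def)
  then show ?thesis
    using group.iso_sym normal.factorgroup_is_group
      comm_group.normal_iff_subgroup[OF comm_group_closure_cycle_group]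
      subgroup_closure_boundaries
    unfolding closure_homology_group_def by metis
qed

end
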